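(* For every positive integer $m$, the metric $m\,g_{EH}$, where $g_{EH}$ is the Eguchi–Hanson metric, is not projectively induced.
   Context: The Eguchi–Hanson metric $g_{EH}$ is Calabi's Ricci flat metric on the total space of the canonical bundle $\Lambda^1\mathbb{C}\mathrm{P}^1=O(-2)$ of $(\mathbb{C}\mathrm{P}^1,g_{FS})$. Explicitly, if $z$ is an affine coordinate on $\mathbb{C}\mathrm{P}^1$ and $\xi$ is the corresponding fibre coordinate (the point $(z,\xi)$ represents the covector $\xi\,dz$ at $z$), then $g_{EH}$ is the Kähler metric with Kähler form $\frac{i}{2\pi}\partial\bar\partial\Psi$, where $$\Psi(z,\xi)=\log(1+|z|^2)+u\big((1+|z|^2)^2|\xi|^2\big),\qquad u(x)=\sqrt{1+cx}-1-\log\frac{\sqrt{1+cx}+1}{2},$$ and $c>0$ is a constant (different values of $c$ give isometric metrics, by rescaling $\xi$). Projectively induced: a Kähler metric $g$ on a complex manifold $X$ is projectively induced if there exists a Kähler (i.e. holomorphic and isometric) immersion of $(X,g)$ into $(\mathbb{C}\mathrm{P}^N,g_{FS})$ for some $N\le+\infty$, where $g_{FS}$ is the Fubini–Study metric with Kähler form $\omega_{FS}=\frac{i}{2\pi}\partial\bar\partial\log(|Z_0|^2+\cdots+|Z_N|^2)$ in homogeneous coordinates ($\mathbb{C}\mathrm{P}^\infty$ is the projectivization of $\ell^2(\mathbb{C})$). *)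

theory Defs
  imports "HOL-Analysis.Analysis" "HOL-Library.Extended_Nat"
begin

section \<open>Complex normed spaces and holomorphic maps\<close>

class complex_normed_vector = real_normed_vector +
  fixes scaleC :: "complex \<Rightarrow> 'a \<Rightarrow> 'a"  (infixr "*\<^sub>C" 75)
  assumes scaleC_add_right: "a *\<^sub>C (x + y) = a *\<^sub>C x + a *\<^sub>C y"
    and scaleC_add_left: "(a + b) *\<^sub>C x = a *\<^sub>C x + b *\<^sub>C x"
    and scaleC_scaleC: "a *\<^sub>C (b *\<^sub>C x) = (a * b) *\<^sub>C x"
    and scaleC_of_real: "complex_of_real r *\<^sub>C x = r *\<^sub>R x"
    and norm_scaleC: "norm (a *\<^sub>C x) = cmod a * norm x"

instantiation complex :: complex_normed_vector
begin

definition scaleC_complex_def: "a *\<^sub>C x = a * (x :: complex)"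

instance
  by standard (auto simp: scaleC_complex_def algebra_simps norm_mult scaleR_conv_of_real)

end

instantiation prod :: (complex_normed_vector, complex_normed_vector) complex_normed_vector
begin

definition scaleC_prod_def: "a *\<^sub>C x = (a *\<^sub>C fst x, a *\<^sub>C snd x)"

instance
proof
  fix a b :: complex and r :: real and x y :: "'a \<times> 'b"
  show "a *\<^sub>C (x + y) = a *\<^sub>C x + a *\<^sub>C y"
    by (simp add: scaleC_prod_def scaleC_add_right)
  show "(a + b) *\<^sub>C x = a *\<^sub>C x + b *\<^sub>C x"
    by (simp add: scaleC_prod_def scaleC_add_left)
  show "a *\<^sub>C (b *\<^sub>C x) = (a * b) *\<^sub>C x"
    by (simp add: scaleC_prod_def scaleC_scaleC)
  show "complex_of_real r *\<^sub>C x = r *\<^sub>R x"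
    by (simp add: scaleC_prod_def scaleC_of_real scaleR_prod_def)
  have "norm (a *\<^sub>C x) = sqrt ((cmod a)\<^sup>2 * ((norm (fst x))\<^sup>2 + (norm (snd x))\<^sup>2))"
    by (simp add: scaleC_prod_def norm_prod_def norm_scaleC power_mult_distrib algebra_simps)
  then show "norm (a *\<^sub>C x) = cmod a * norm x"
    by (simp add: norm_prod_def real_sqrt_mult)
qed

end

definition holo_on ::
  "('v::complex_normed_vector \<Rightarrow> 'w::complex_normed_vector) \<Rightarrow> 'v set \<Rightarrow> bool" where
  "holo_on F U \<longleftrightarrow>
     (\<forall>p\<in>U. \<exists>F'. (F has_derivative F') (at p) \<and> (\<forall>a v. F' (a *\<^sub>C v) = a *\<^sub>C F' v))"


section \<open>Kaehler forms and metrics with a given potential\<close>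

definition del :: "('v::complex_normed_vector \<Rightarrow> complex) \<Rightarrow> 'v \<Rightarrow> 'v \<Rightarrow> complex" where
  "del f p v =
     (frechet_derivative f (at p) v - \<i> * frechet_derivative f (at p) (\<i> *\<^sub>C v)) / 2"

definition delbar :: "('v::complex_normed_vector \<Rightarrow> complex) \<Rightarrow> 'v \<Rightarrow> 'v \<Rightarrow> complex" where
  "delbar f p v =
     (frechet_derivative f (at p) v + \<i> * frechet_derivative f (at p) (\<i> *\<^sub>C v)) / 2"

text \<open>In coordinates, \<open>levi_form \<rho> p u v\<close> is the sum over \<open>j, k\<close> of
  \<open>(\<partial>\<^sup>2\<rho> / \<partial>z\<^sub>j \<partial>cnj z\<^sub>k) u\<^sub>j (cnj v\<^sub>k)\<close>, and \<open>del_delbar \<rho> p u v\<close> is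
  the value on \<open>(u, v)\<close> of the 2-form obtained by applying first delbar and then del to \<open>\<rho>\<close>, i.e.
  the same sum with \<open>dz\<^sub>j \<and> d(cnj z\<^sub>k)\<close> in place of \<open>u\<^sub>j (cnj v\<^sub>k)\<close>.\<close>

definition levi_form :: "('v::complex_normed_vector \<Rightarrow> real) \<Rightarrow> 'v \<Rightarrow> 'v \<Rightarrow> 'v \<Rightarrow> complex" where
  "levi_form \<rho> p u v = del (\<lambda>q. delbar (\<lambda>x. complex_of_real (\<rho> x)) q v) p u"

definition del_delbar :: "('v::complex_normed_vector \<Rightarrow> real) \<Rightarrow> 'v \<Rightarrow> 'v \<Rightarrow> 'v \<Rightarrow> complex" where
  "del_delbar \<rho> p u v = levi_form \<rho> p u v - levi_form \<rho> p v u"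

text \<open>The Kaehler form is \<open>i / (2 \<pi>)\<close> times that form. For potentials of class
  \<open>C\<^sup>2\<close> it is real-valued; \<open>Re\<close> only adjusts the type.\<close>

definition kahler_form :: "('v::complex_normed_vector \<Rightarrow> real) \<Rightarrow> 'v \<Rightarrow> 'v \<Rightarrow> 'v \<Rightarrow> real" where
  "kahler_form \<rho> p u v = Re (\<i> / (2 * of_real pi) * del_delbar \<rho> p u v)"

text \<open>The metric \<open>g\<close> with Kaehler form \<open>\<omega>\<close> is \<open>g(u, v) = \<omega>(u, i v)\<close>, which is nonnegative for
  plurisubharmonic potentials.\<close>

definition kahler_metric :: "('v::complex_normed_vector \<Rightarrow> real) \<Rightarrow> 'v \<Rightarrow> 'v \<Rightarrow> 'v \<Rightarrow> real" where
  "kahler_metric \<rho> p u v = kahler_form \<rho> p u (\<i> *\<^sub>C v)"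


section \<open>The Hilbert space of square-summable complex sequences\<close>

typedef l2 = "{f :: nat \<Rightarrow> complex. summable (\<lambda>i. (cmod (f i))\<^sup>2)}"
  morphisms l2_coord Abs_l2
  by (rule exI[of _ "\<lambda>_. 0"]) simp

setup_lifting type_definition_l2

lemma l2_summable: "summable (\<lambda>i. (cmod (l2_coord x i))\<^sup>2)"
  using l2_coord[of x] by simp

lemma l2_eqI: "(\<And>i. l2_coord x i = l2_coord y i) \<Longrightarrow> x = y"
  using l2_coord_inject by blast

lemma sum_sq_le: "(cmod (a + b))\<^sup>2 \<le> 2 * (cmod a)\<^sup>2 + 2 * (cmod b)\<^sup>2"
proof -
  have "(cmod (a + b))\<^sup>2 \<le> (cmod a + cmod b)\<^sup>2"
    by (intro power_mono norm_triangle_ineq norm_ge_zero)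
  also have "\<dots> \<le> 2 * (cmod a)\<^sup>2 + 2 * (cmod b)\<^sup>2"
    using sum_squares_bound[of "cmod a" "cmod b"] by (simp add: power2_sum)
  finally show ?thesis .
qed

lemma square_summable_add:
  fixes f g :: "nat \<Rightarrow> complex"
  assumes "summable (\<lambda>i. (cmod (f i))\<^sup>2)" "summable (\<lambda>i. (cmod (g i))\<^sup>2)"
  shows "summable (\<lambda>i. (cmod (f i + g i))\<^sup>2)"
  by (rule summable_comparison_test'[of "\<lambda>i. 2 * (cmod (f i))\<^sup>2 + 2 * (cmod (g i))\<^sup>2" 0])
     (intro summable_add summable_mult assms, simp add: sum_sq_le)

lemma square_summable_inner:
  fixes f g :: "nat \<Rightarrow> complex"
  assumes "summable (\<lambda>i. (cmod (f i))\<^sup>2)" "summable (\<lambda>i. (cmod (g i))\<^sup>2)"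
  shows "summable (\<lambda>i. f i \<bullet> g i)"
proof (rule summable_comparison_test'[of "\<lambda>i. (cmod (f i))\<^sup>2 + (cmod (g i))\<^sup>2" 0])
  show "summable (\<lambda>i. (cmod (f i))\<^sup>2 + (cmod (g i))\<^sup>2)"
    using assms by (rule summable_add)
  fix i
  have "\<bar>f i \<bullet> g i\<bar> \<le> cmod (f i) * cmod (g i)"
    by (rule Cauchy_Schwarz_ineq2)
  also have "\<dots> \<le> (cmod (f i))\<^sup>2 + (cmod (g i))\<^sup>2"
  proof -
    have half: "b \<le> s" if "2 * b \<le> s" "0 \<le> b" for b s :: real
      using that by linarith
    have "2 * (cmod (f i) * cmod (g i)) \<le> (cmod (f i))\<^sup>2 + (cmod (g i))\<^sup>2"
      using sum_squares_bound[of "cmod (f i)" "cmod (g i)"] by (simp add: mult.assoc)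
    then show ?thesis by (rule half) simp
  qed
  finally show "norm (f i \<bullet> g i) \<le> (cmod (f i))\<^sup>2 + (cmod (g i))\<^sup>2"
    by simp
qed

instantiation l2 :: real_inner
begin

lift_definition zero_l2 :: l2 is "\<lambda>_. 0" by simp

lift_definition plus_l2 :: "l2 \<Rightarrow> l2 \<Rightarrow> l2" is "\<lambda>f g i. f i + g i"
  by (simp add: square_summable_add)

lift_definition uminus_l2 :: "l2 \<Rightarrow> l2" is "\<lambda>f i. - f i" by simp

lift_definition minus_l2 :: "l2 \<Rightarrow> l2 \<Rightarrow> l2" is "\<lambda>f g i. f i - g i"
  subgoal for f g using square_summable_add[of f "\<lambda>i. - g i"] by simp
  done

lift_definition scaleR_l2 :: "real \<Rightarrow> l2 \<Rightarrow> l2" is "\<lambda>r f i. r *\<^sub>R f i"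
  by (simp add: power_mult_distrib summable_mult)

definition inner_l2_def: "x \<bullet> y = (\<Sum>i. l2_coord x i \<bullet> l2_coord y i)"

definition norm_l2_def: "norm (x :: l2) = sqrt (x \<bullet> x)"

definition dist_l2_def: "dist (x :: l2) y = norm (x - y)"

definition sgn_l2_def: "sgn (x :: l2) = inverse (norm x) *\<^sub>R x"

definition uniformity_l2_def:
  "(uniformity :: (l2 \<times> l2) filter) = (INF e\<in>{0<..}. principal {(x, y). dist x y < e})"

definition open_l2_def:
  "open (U :: l2 set) = (\<forall>x\<in>U. eventually (\<lambda>(x', y). x' = x \<longrightarrow> y \<in> U) uniformity)"

instance
proof
  fix x y z :: l2 and r s :: real and U :: "l2 set"
  note S = square_summable_inner[OF l2_summable l2_summable]
  show "x + y + z = x + (y + z)" by transfer (simp add: algebra_simps)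
  show "x + y = y + x" by transfer (simp add: algebra_simps)
  show "0 + x = x" by transfer simp
  show "- x + x = 0" by transfer simp
  show "x - y = x + - y" by transfer simp
  show "r *\<^sub>R (x + y) = r *\<^sub>R x + r *\<^sub>R y" by transfer (simp add: algebra_simps)
  show "(r + s) *\<^sub>R x = r *\<^sub>R x + s *\<^sub>R x" by transfer (simp add: algebra_simps)
  show "r *\<^sub>R s *\<^sub>R x = (r * s) *\<^sub>R x" by transfer (simp add: algebra_simps)
  show "1 *\<^sub>R x = x" by transfer simp
  show "dist x y = norm (x - y)" by (rule dist_l2_def)
  show "sgn x = inverse (norm x) *\<^sub>R x" by (rule sgn_l2_def)
  show "uniformity = (INF e\<in>{0<..}. principal {(x :: l2, y). dist x y < e})"
    by (rule uniformity_l2_def)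
  show "open U = (\<forall>x\<in>U. eventually (\<lambda>(x', y). x' = x \<longrightarrow> y \<in> U) uniformity)"
    by (rule open_l2_def)
  show "x \<bullet> y = y \<bullet> x" by (simp add: inner_l2_def inner_commute)
  show "(x + y) \<bullet> z = x \<bullet> z + y \<bullet> z"
    by (simp add: inner_l2_def plus_l2.rep_eq inner_add_left suminf_add[OF S S])
  show "(r *\<^sub>R x) \<bullet> y = r * (x \<bullet> y)"
    by (simp add: inner_l2_def scaleR_l2.rep_eq suminf_mult[OF S])
  show "0 \<le> x \<bullet> x"
    by (simp add: inner_l2_def suminf_nonneg[OF S])
  have "x \<bullet> x = 0 \<longleftrightarrow> (\<forall>i. l2_coord x i \<bullet> l2_coord x i = 0)"
    unfolding inner_l2_def by (rule suminf_eq_zero_iff[OF S]) simp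
  also have "\<dots> \<longleftrightarrow> x = 0"
    by (auto simp: zero_l2.rep_eq intro!: l2_eqI)
  finally show "x \<bullet> x = 0 \<longleftrightarrow> x = 0" .
  show "norm x = sqrt (x \<bullet> x)" by (rule norm_l2_def)
qed

end

lemma norm_l2_sq: "(norm x)\<^sup>2 = (\<Sum>i. (cmod (l2_coord x i))\<^sup>2)"
  by (simp add: power2_norm_eq_inner inner_l2_def)

instantiation l2 :: complex_normed_vector
begin

lift_definition scaleC_l2 :: "complex \<Rightarrow> l2 \<Rightarrow> l2" is "\<lambda>a f i. a * f i"
  by (simp add: norm_mult power_mult_distrib summable_mult)

instance
proof
  fix a b :: complex and r :: real and x y :: l2
  show "a *\<^sub>C (x + y) = a *\<^sub>C x + a *\<^sub>C y" by transfer (simp add: algebra_simps)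
  show "(a + b) *\<^sub>C x = a *\<^sub>C x + b *\<^sub>C x" by transfer (simp add: algebra_simps)
  show "a *\<^sub>C (b *\<^sub>C x) = (a * b) *\<^sub>C x" by transfer (simp add: algebra_simps)
  show "complex_of_real r *\<^sub>C x = r *\<^sub>R x"
    by transfer (simp add: scaleR_conv_of_real)
  have "(norm (a *\<^sub>C x))\<^sup>2 = (cmod a * norm x)\<^sup>2"
    by (simp add: norm_l2_sq scaleC_l2.rep_eq norm_mult power_mult_distrib
        suminf_mult[OF l2_summable])
  then show "norm (a *\<^sub>C x) = cmod a * norm x"
    by (simp add: power2_eq_iff_nonneg)
qed

end


section \<open>Complex projective space of dimension at most \<open>\<infinity>\<close>\<close>

definition complex_line :: "'v::complex_normed_vector \<Rightarrow> 'v set" where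
  "complex_line Z = range (\<lambda>a. a *\<^sub>C Z)"

text \<open>\<open>CP N\<close> has the homogeneous coordinates \<open>Z\<^sub>0, \<dots>, Z\<^sub>N\<close>; \<open>CP \<infinity>\<close> is the projectivization
  of the whole space \<open>l2\<close>.\<close>

definition CP :: "enat \<Rightarrow> l2 set set" where
  "CP N = complex_line ` {Z. Z \<noteq> 0 \<and> (\<forall>i. N < enat i \<longrightarrow> l2_coord Z i = 0)}"

text \<open>The Fubini--Study metric in homogeneous coordinates, i.e. pulled back along
  \<open>Z \<mapsto> complex_line Z\<close>. By \<open>norm_l2_sq\<close> the potential is the logarithm of the sum of the
  \<open>(cmod Z\<^sub>i)\<^sup>2\<close>.\<close>

definition fs_metric :: "l2 \<Rightarrow> l2 \<Rightarrow> l2 \<Rightarrow> real" where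
  "fs_metric = kahler_metric (\<lambda>Z. ln ((norm Z)\<^sup>2))"


section \<open>Complex manifolds and Kaehler immersions into projective space\<close>

text \<open>A complex manifold is given by parametrizations \<open>\<phi> i : D i \<rightarrow> X\<close> (the inverses of its
  holomorphic charts), where \<open>X\<close> is a whole type. A metric on it is a family \<open>g\<close>, where \<open>g i p u v\<close>
  is the inner product of the tangent vectors \<open>u, v\<close> at \<open>p \<in> D i\<close> in the \<open>i\<close>-th coordinates.\<close>

definition complex_atlas ::
  "('i \<Rightarrow> 'v::complex_normed_vector set) \<Rightarrow> ('i \<Rightarrow> 'v \<Rightarrow> 'x) \<Rightarrow> bool" where
  "complex_atlas D \<phi> \<longleftrightarrow>
     (\<forall>i. open (D i) \<and> inj_on (\<phi> i) (D i)) \<and>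
     (\<Union>i. \<phi> i ` D i) = UNIV \<and>
     (\<forall>i j. open {p \<in> D i. \<phi> i p \<in> \<phi> j ` D j} \<and>
            holo_on (\<lambda>p. inv_into (D j) (\<phi> j) (\<phi> i p)) {p \<in> D i. \<phi> i p \<in> \<phi> j ` D j}) \<and>
     (\<forall>x y. x \<noteq> y \<longrightarrow>
        (\<exists>i j U V. open U \<and> U \<subseteq> D i \<and> open V \<and> V \<subseteq> D j \<and>
                   x \<in> \<phi> i ` U \<and> y \<in> \<phi> j ` V \<and> \<phi> i ` U \<inter> \<phi> j ` V = {}))"

text \<open>\<open>F\<close> expresses \<open>f\<close> in homogeneous coordinates over the coordinate domain \<open>U\<close>.\<close>

definition holo_lift ::
  "('v::complex_normed_vector \<Rightarrow> 'x) \<Rightarrow> ('x \<Rightarrow> l2 set) \<Rightarrow> 'v set \<Rightarrow> ('v \<Rightarrow> l2) \<Rightarrow> bool" where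
  "holo_lift \<phi> f U F \<longleftrightarrow>
     open U \<and> holo_on F U \<and> (\<forall>p\<in>U. F p \<noteq> 0 \<and> f (\<phi> p) = complex_line (F p))"

definition holo_map ::
  "('i \<Rightarrow> 'v::complex_normed_vector set) \<Rightarrow> ('i \<Rightarrow> 'v \<Rightarrow> 'x) \<Rightarrow> ('x \<Rightarrow> l2 set) \<Rightarrow> bool" where
  "holo_map D \<phi> f \<longleftrightarrow>
     (\<forall>i. \<forall>p\<in>D i. \<exists>U F. p \<in> U \<and> U \<subseteq> D i \<and> holo_lift (\<phi> i) f U F)"

text \<open>The kernel of the differential of \<open>Z \<mapsto> complex_line Z\<close> at \<open>Z\<close> is \<open>complex_line Z\<close>, so the
  following says that the differential of \<open>f\<close> is injective at every point.\<close>

definition immersive ::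
  "('i \<Rightarrow> 'v::complex_normed_vector set) \<Rightarrow> ('i \<Rightarrow> 'v \<Rightarrow> 'x) \<Rightarrow> ('x \<Rightarrow> l2 set) \<Rightarrow> bool" where
  "immersive D \<phi> f \<longleftrightarrow>
     (\<forall>i U F. U \<subseteq> D i \<and> holo_lift (\<phi> i) f U F \<longrightarrow>
        (\<forall>p\<in>U. \<forall>v. frechet_derivative F (at p) v \<in> complex_line (F p) \<longrightarrow> v = 0))"

definition isometric ::
  "('i \<Rightarrow> 'v::complex_normed_vector set) \<Rightarrow> ('i \<Rightarrow> 'v \<Rightarrow> 'x) \<Rightarrow>
     ('i \<Rightarrow> 'v \<Rightarrow> 'v \<Rightarrow> 'v \<Rightarrow> real) \<Rightarrow> ('x \<Rightarrow> l2 set) \<Rightarrow> bool" where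
  "isometric D \<phi> g f \<longleftrightarrow>
     (\<forall>i U F. U \<subseteq> D i \<and> holo_lift (\<phi> i) f U F \<longrightarrow>
        (\<forall>p\<in>U. \<forall>u v. fs_metric (F p) (frechet_derivative F (at p) u) (frechet_derivative F (at p) v)
                       = g i p u v))"

definition kahler_immersion ::
  "('i \<Rightarrow> 'v::complex_normed_vector set) \<Rightarrow> ('i \<Rightarrow> 'v \<Rightarrow> 'x) \<Rightarrow>
     ('i \<Rightarrow> 'v \<Rightarrow> 'v \<Rightarrow> 'v \<Rightarrow> real) \<Rightarrow> enat \<Rightarrow> ('x \<Rightarrow> l2 set) \<Rightarrow> bool" where
  "kahler_immersion D \<phi> g N f \<longleftrightarrow>
     range f \<subseteq> CP N \<and> holo_map D \<phi> f \<and> immersive D \<phi> f \<and> isometric D \<phi> g f"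

definition projectively_induced ::
  "('i \<Rightarrow> 'v::complex_normed_vector set) \<Rightarrow> ('i \<Rightarrow> 'v \<Rightarrow> 'x) \<Rightarrow>
     ('i \<Rightarrow> 'v \<Rightarrow> 'v \<Rightarrow> 'v \<Rightarrow> real) \<Rightarrow> bool" where
  "projectively_induced D \<phi> g \<longleftrightarrow> (\<exists>N f. kahler_immersion D \<phi> g N f)"


section \<open>The canonical bundle of \<open>CP\<^sup>1\<close> and the Eguchi--Hanson metric\<close>

text \<open>The total space is glued from two copies of the complex plane squared. In the copy \<open>False\<close> the
  point \<open>(z, \<xi>)\<close> is the covector \<open>\<xi> dz\<close> at \<open>z\<close>; in the copy \<open>True\<close> it is \<open>\<xi> dw\<close> at the point with
  affine coordinate \<open>w = 1/z\<close>. Since \<open>dz = - z\<^sup>2 dw\<close>, the same formula changes coordinates in both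
  directions.\<close>

definition eh_transition :: "complex \<times> complex \<Rightarrow> complex \<times> complex" where
  "eh_transition = (\<lambda>(z, \<xi>). (1 / z, - (z\<^sup>2) * \<xi>))"

definition eh_rel :: "bool \<times> complex \<times> complex \<Rightarrow> bool \<times> complex \<times> complex \<Rightarrow> bool" where
  "eh_rel = (\<lambda>(i, p) (j, q). if i = j then p = q else fst p \<noteq> 0 \<and> q = eh_transition p)"

lemma eh_transition_invol: "fst p \<noteq> 0 \<Longrightarrow> eh_transition (eh_transition p) = p"
  by (cases p) (simp add: eh_transition_def field_simps)

lemma fst_eh_transition: "fst (eh_transition p) = 1 / fst p"
  by (cases p) (simp add: eh_transition_def)

quotient_type eh_space = "bool \<times> complex \<times> complex" / eh_rel
proof (rule equivpI)
  show "reflp eh_rel" by (auto simp: reflp_def eh_rel_def)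
  show "symp eh_rel"
    by (auto simp: symp_def eh_rel_def fst_eh_transition eh_transition_invol split: if_splits)
  show "transp eh_rel"
    unfolding transp_def eh_rel_def
    by (auto simp: fst_eh_transition eh_transition_invol split: if_splits)
qed

definition eh_param :: "bool \<Rightarrow> complex \<times> complex \<Rightarrow> eh_space" where
  "eh_param i p = abs_eh_space (i, p)"

definition eh_dom :: "bool \<Rightarrow> (complex \<times> complex) set" where
  "eh_dom i = UNIV"

lemma eh_param_eq_iff:
  "eh_param i p = eh_param j q \<longleftrightarrow>
     (if i = j then p = q else fst p \<noteq> 0 \<and> q = eh_transition p)"
  by (simp add: eh_param_def eh_space.abs_eq_iff eh_rel_def)

lemma eh_transition_holo: "holo_on eh_transition {p. fst p \<noteq> 0}"
  unfolding holo_on_def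
proof (intro ballI exI conjI allI)
  fix p :: "complex \<times> complex" assume "p \<in> {p. fst p \<noteq> 0}"
  then have p: "fst p \<noteq> 0" by simp
  let ?F' = "\<lambda>v. (- fst v / (fst p)\<^sup>2, - (2 * fst p * fst v * snd p) - (fst p)\<^sup>2 * snd v)"
  have "((\<lambda>p :: complex \<times> complex. (inverse (fst p), - ((fst p)\<^sup>2 * snd p)))
          has_derivative ?F') (at p)"
    using p by (auto intro!: derivative_eq_intros simp: fun_eq_iff field_simps power2_eq_square)
  then show "(eh_transition has_derivative ?F') (at p)"
    by (simp add: eh_transition_def case_prod_unfold divide_inverse)
  fix a v
  show "?F' (a *\<^sub>C v) = a *\<^sub>C ?F' v"
    by (simp add: scaleC_prod_def scaleC_complex_def algebra_simps)
qed

lemma eh_param_surj: "\<exists>i p. x = eh_param i p"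
proof (induct x rule: eh_space.abs_induct)
  case (1 y)
  then show ?case by (cases y) (auto simp: eh_param_def)
qed

lemma eh_space_is_complex_manifold: "complex_atlas eh_dom eh_param"
  unfolding complex_atlas_def
proof (intro conjI allI impI)
  show "open (eh_dom i)" for i by (simp add: eh_dom_def)
  show "inj_on (eh_param i) (eh_dom i)" for i by (simp add: inj_on_def eh_param_eq_iff)
  show "(\<Union>i. eh_param i ` eh_dom i) = UNIV"
    using eh_param_surj unfolding eh_dom_def by blast
  fix i j
  have dom: "{p \<in> eh_dom i. eh_param i p \<in> eh_param j ` eh_dom j}
      = (if i = j then UNIV else {p. fst p \<noteq> 0})"
    by (cases "i = j") (simp_all add: eh_dom_def eh_param_eq_iff image_iff del: split_paired_Ex)
  have op: "open {p :: complex \<times> complex. fst p \<noteq> 0}"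
    by (intro open_Collect_neq continuous_intros)
  then show "open {p \<in> eh_dom i. eh_param i p \<in> eh_param j ` eh_dom j}"
    unfolding dom by simp
  have inv: "inv_into (eh_dom j) (eh_param j) (eh_param i p)
      = (if i = j then p else eh_transition p)" if "i \<noteq> j \<longrightarrow> fst p \<noteq> 0" for p
  proof (rule inv_into_f_eq)
    show "inj_on (eh_param j) (eh_dom j)" by (simp add: inj_on_def eh_param_eq_iff)
  qed (use that in \<open>auto simp: eh_dom_def eh_param_eq_iff fst_eh_transition eh_transition_invol\<close>)
  show "holo_on (\<lambda>p. inv_into (eh_dom j) (eh_param j) (eh_param i p))
          {p \<in> eh_dom i. eh_param i p \<in> eh_param j ` eh_dom j}"
  proof (cases "i = j")
    case True
    have "((\<lambda>p. p) has_derivative (\<lambda>v. v)) (at p)" for p :: "complex \<times> complex"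
      by (rule has_derivative_ident)
    moreover have "(\<lambda>p. inv_into (eh_dom j) (eh_param j) (eh_param i p)) = (\<lambda>p. p)"
      using True inv by (simp add: fun_eq_iff)
    ultimately show ?thesis
      unfolding holo_on_def by (intro ballI exI[of _ "\<lambda>v. v"]) simp
  next
    case False
    show ?thesis
      unfolding holo_on_def
    proof (intro ballI)
      fix p assume "p \<in> {p \<in> eh_dom i. eh_param i p \<in> eh_param j ` eh_dom j}"
      then have p: "p \<in> {p. fst p \<noteq> 0}" using False unfolding dom by simp
      then obtain F' where F': "(eh_transition has_derivative F') (at p)"
        "\<forall>a v. F' (a *\<^sub>C v) = a *\<^sub>C F' v"
        using eh_transition_holo unfolding holo_on_def by blast
      have "((\<lambda>p. inv_into (eh_dom j) (eh_param j) (eh_param i p)) has_derivative F') (at p)"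
        by (rule has_derivative_transform_within_open[OF F'(1) op p]) (use False inv in auto)
      with F'(2) show "\<exists>F'. ((\<lambda>p. inv_into (eh_dom j) (eh_param j) (eh_param i p))
          has_derivative F') (at p) \<and> (\<forall>a v. F' (a *\<^sub>C v) = a *\<^sub>C F' v)" by blast
    qed
  qed
next
  fix x y :: eh_space assume "x \<noteq> y"
  obtain i p j q where xy: "x = eh_param i p" "y = eh_param j q"
    using eh_param_surj[of x] eh_param_surj[of y] by blast
  have same: "\<exists>i j U V. open U \<and> U \<subseteq> eh_dom i \<and> open V \<and> V \<subseteq> eh_dom j \<and>
      x \<in> eh_param i ` U \<and> y \<in> eh_param j ` V \<and> eh_param i ` U \<inter> eh_param j ` V = {}"
    if "x = eh_param k r" "y = eh_param k s" for k r s
  proof -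
    have "r \<noteq> s" using that \<open>x \<noteq> y\<close> by auto
    from hausdorff[OF this] obtain U V
      where UV: "open U" "open V" "r \<in> U" "s \<in> V" "U \<inter> V = {}" by blast
    have "eh_param k ` U \<inter> eh_param k ` V = {}"
      using UV(5) by (auto simp: eh_param_eq_iff simp del: split_paired_All)
    then show ?thesis
      using that UV unfolding eh_dom_def by (metis imageI subset_UNIV)
  qed
  show "\<exists>i j U V. open U \<and> U \<subseteq> eh_dom i \<and> open V \<and> V \<subseteq> eh_dom j \<and>
      x \<in> eh_param i ` U \<and> y \<in> eh_param j ` V \<and> eh_param i ` U \<inter> eh_param j ` V = {}"
  proof (cases "i = j \<or> fst p \<noteq> 0 \<or> fst q \<noteq> 0")
    case True
    then consider "i = j" | "i \<noteq> j" "fst p \<noteq> 0" | "i \<noteq> j" "fst q \<noteq> 0" by blast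
    then show ?thesis
    proof cases
      case 1
      with xy show ?thesis by (intro same[of i p q]) simp_all
    next
      case 2
      with xy have "x = eh_param j (eh_transition p)" by (simp add: eh_param_eq_iff)
      from this xy(2) show ?thesis by (rule same)
    next
      case 3
      with xy have "y = eh_param i (eh_transition q)"
        by (metis eh_param_eq_iff)
      with xy(1) show ?thesis by (rule same)
    qed
  next
    case False
    let ?U = "{p :: complex \<times> complex. cmod (fst p) < 1}"
    have "open ?U" by (intro open_Collect_less continuous_intros)
    moreover have "eh_param i ` ?U \<inter> eh_param j ` ?U = {}"
    proof -
      have "\<not> cmod (fst (eh_transition r)) < 1" if "cmod (fst r) < 1" "fst r \<noteq> 0" for r
        using that by (simp add: fst_eh_transition norm_divide)
      then show ?thesis
        using False by (auto simp: eh_param_eq_iff)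
    qed
    ultimately show ?thesis
      using False xy
      by (intro exI[of _ i] exI[of _ j] exI[of _ ?U]) (auto simp: eh_dom_def)
  qed
qed

definition eh_u :: "real \<Rightarrow> real \<Rightarrow> real" where
  "eh_u c x = sqrt (1 + c * x) - 1 - ln ((sqrt (1 + c * x) + 1) / 2)"

definition eh_potential :: "real \<Rightarrow> complex \<times> complex \<Rightarrow> real" where
  "eh_potential c = (\<lambda>(z, \<xi>).
     ln (1 + (cmod z)\<^sup>2) + eh_u c ((1 + (cmod z)\<^sup>2)\<^sup>2 * (cmod \<xi>)\<^sup>2))"

text \<open>By symmetry the potential has the same formula in both coordinate systems: on the overlap the
  two differ by the pluriharmonic function \<open>ln ((cmod z)\<^sup>2)\<close>, so they define the same metric.\<close>

definition eh_metric ::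
  "real \<Rightarrow> bool \<Rightarrow> complex \<times> complex \<Rightarrow> complex \<times> complex \<Rightarrow> complex \<times> complex \<Rightarrow> real" where
  "eh_metric c i = kahler_metric (eh_potential c)"

lemma eh_potential_transition:
  assumes "z \<noteq> 0"
  shows "eh_potential c (eh_transition (z, \<xi>)) = eh_potential c (z, \<xi>) - ln ((cmod z)\<^sup>2)"
proof -
  have pos: "(cmod z)\<^sup>2 > 0" "1 + (cmod z)\<^sup>2 > 0"
    using assms by (simp_all add: add_pos_nonneg)
  have 1: "1 + (cmod (1 / z))\<^sup>2 = (1 + (cmod z)\<^sup>2) / (cmod z)\<^sup>2"
    using pos by (simp add: norm_divide power_divide field_simps)
  have 2: "(1 + (cmod (1 / z))\<^sup>2)\<^sup>2 * (cmod (- (z\<^sup>2) * \<xi>))\<^sup>2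
           = (1 + (cmod z)\<^sup>2)\<^sup>2 * (cmod \<xi>)\<^sup>2"
    unfolding 1 using assms by (simp add: norm_mult norm_power power_mult_distrib power_divide)
  have 3: "ln (1 + (cmod (1 / z))\<^sup>2) = ln (1 + (cmod z)\<^sup>2) - ln ((cmod z)\<^sup>2)"
    unfolding 1 using pos by (subst ln_div) auto
  show ?thesis
    unfolding eh_potential_def eh_transition_def prod.case 2 3 by simp
qed

end

theory Submission
  imports Defs "HOL-Complex_Analysis.Complex_Analysis"
begin

text \<open>
  A Kaehler immersion is already contradictory on one fibre of the bundle, the fibre over
  \<open>z = 0\<close>. The fibre carries the metric with potential \<open>m u(|\<xi>|\<^sup>2)\<close>, and \<open>e\<^sup>m\<^sup>u\<close> is the
  value at \<open>x = |\<xi>|\<^sup>2\<close> of the function \<open>E(x) = exp (m (s - 1)) (2 / (s + 1))\<^sup>m\<close>, where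
  \<open>s = sqrt (1 + c x)\<close>. The square root branches at \<open>x = -1/c\<close>.

  Let \<open>F\<close> be a lift of the immersion to homogeneous coordinates near the point \<open>\<xi> = 0\<close> of
  this fibre, restricted to the fibre. Equality of the metrics says that
  \<open>log |F|\<^sup>2 - m u(|\<xi>|\<^sup>2)\<close> is harmonic, so \<open>F\<close> can be multiplied by a nowhere vanishing holomorphic function to give a map \<open>G\<close> with
  \<open>|G(\<xi>)|\<^sup>2 = C E(|\<xi>|\<^sup>2)\<close> for a constant \<open>C\<close> (\<open>holomorphic_normalization\<close>). Applying
  \<open>\<partial>\<^sup>2 / \<partial>\<xi> \<partial>(cnj \<xi>)\<close> to this identity \<open>k\<close> times and evaluating at 0 expresses the \<open>k\<close>-th
  Taylor coefficient of \<open>C E\<close> as a nonnegative multiple of \<open>|G\<^sup>(\<^sup>k\<^sup>)(0)|\<^sup>2\<close>; hence all these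
  coefficients are nonnegative (\<open>taylor_coefficients_nonneg\<close>). This is one
  direction of Calabi's criterion.

  On the other hand \<open>E\<close> is holomorphic on the half-plane \<open>Re x > -1/c\<close>, in particular near the
  point \<open>1/c\<close> of the circle \<open>|x| = 1/c\<close>. By Pringsheim's theorem a power series with nonnegative
  coefficients which continues past the positive point of a circle converges on a larger disc
  (\<open>pringsheim_extension\<close>), so \<open>E\<close> would continue holomorphically past \<open>-1/c\<close>. That is impossible, as
  \<open>-1/c\<close> is a branch point (\<open>no_extension_beyond_branch_point\<close>).

  The derivatives of \<open>G\<close> are taken in the norm of the sequence space, and the hypothesis only
  provides the first one. The others come from \<open>l2_derivative_has_derivative\<close>: finite linear
  combinations of the coordinates are scalar holomorphic functions, and Cauchy's estimates for them
  are proportional to the norm of the vector of coefficients.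
\<close>

section \<open>Hermitian products and the Fubini--Study metric\<close>

text \<open>In a complex normed space whose norm comes from a real inner product, multiplication by \<open>\<i>\<close> is
  an isometry, so the real inner product is the real part of a Hermitian one, which is linear in the
  first and antilinear in the second argument.\<close>

definition cinner :: "'a::{complex_normed_vector,real_inner} \<Rightarrow> 'a \<Rightarrow> complex" where
  "cinner x y = Complex (x \<bullet> y) (x \<bullet> (\<i> *\<^sub>C y))"

lemma i_scaleC_i_scaleC: "\<i> *\<^sub>C \<i> *\<^sub>C x = - (x :: 'a::complex_normed_vector)"
  using scaleC_of_real[of "-1" x] by (simp add: scaleC_scaleC)

lemma scaleC_eq: "a *\<^sub>C x = Re a *\<^sub>R x + Im a *\<^sub>R (\<i> *\<^sub>C (x :: 'a::complex_normed_vector))"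
proof -
  have "a = complex_of_real (Re a) + complex_of_real (Im a) * \<i>"
    by (simp add: complex_eq_iff)
  then have "a *\<^sub>C x = complex_of_real (Re a) *\<^sub>C x + complex_of_real (Im a) *\<^sub>C \<i> *\<^sub>C x"
    by (metis scaleC_add_left scaleC_scaleC)
  then show ?thesis by (simp only: scaleC_of_real)
qed

lemma inner_i_scaleC_both:
  "(\<i> *\<^sub>C x) \<bullet> (\<i> *\<^sub>C y) = x \<bullet> (y :: 'a::{complex_normed_vector,real_inner})"
  by (simp add: dot_norm norm_scaleC flip: scaleC_add_right)

lemma inner_i_scaleC_left:
  "(\<i> *\<^sub>C x) \<bullet> y = - (x \<bullet> (\<i> *\<^sub>C (y :: 'a::{complex_normed_vector,real_inner})))"
  using inner_i_scaleC_both[of "\<i> *\<^sub>C x" y] by (simp add: i_scaleC_i_scaleC)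

lemma cnj_cinner: "cnj (cinner x y) = cinner y x"
  using inner_i_scaleC_left[of x y] by (simp add: cinner_def complex_eq_iff inner_commute)

lemma cinner_scaleC_left: "cinner (a *\<^sub>C x) y = a * cinner x y"
  by (subst scaleC_eq)
     (simp add: cinner_def complex_eq_iff inner_add_left inner_i_scaleC_left i_scaleC_i_scaleC)

lemma cinner_scaleC_right: "cinner x (a *\<^sub>C y) = cnj a * cinner x y"
  by (metis cinner_scaleC_left cnj_cinner complex_cnj_mult)

lemma cinner_self: "cinner x x = complex_of_real ((norm x)\<^sup>2)"
  using inner_i_scaleC_left[of x x]
  by (simp add: cinner_def complex_eq_iff power2_norm_eq_inner inner_commute)

lemma scaleC_scaleR: "a *\<^sub>C (r *\<^sub>R x) = r *\<^sub>R (a *\<^sub>C (x :: 'a::complex_normed_vector))"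
  by (metis mult.commute scaleC_of_real scaleC_scaleC)

lemma bounded_bilinear_cinner: "bounded_bilinear cinner"
proof
  show "\<exists>K. \<forall>x y :: 'a. cmod (cinner x y) \<le> norm x * norm y * K"
  proof (intro exI allI)
    fix x y :: 'a
    have "cmod (cinner x y) \<le> \<bar>x \<bullet> y\<bar> + \<bar>x \<bullet> (\<i> *\<^sub>C y)\<bar>"
      using cmod_le[of "cinner x y"] by (simp add: cinner_def)
    also have "\<dots> \<le> norm x * norm y + norm x * norm (\<i> *\<^sub>C y)"
      by (intro add_mono Cauchy_Schwarz_ineq2)
    finally show "cmod (cinner x y) \<le> norm x * norm y * 2"
      by (simp add: norm_scaleC)
  qed
qed (simp_all add: cinner_def complex_eq_iff inner_add_left inner_add_right scaleC_add_right
      scaleC_scaleR)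

lemma bounded_bilinear_scaleC: "bounded_bilinear (*\<^sub>C)"
proof
  show "\<exists>K. \<forall>a (x :: 'a). norm (a *\<^sub>C x) \<le> norm a * norm x * K"
    by (intro exI[of _ 1]) (simp add: norm_scaleC)
qed (simp_all add: scaleC_add_left scaleC_add_right scaleC_scaleR scaleR_conv_of_real
      flip: scaleC_of_real, simp_all add: scaleC_scaleC mult.commute)

lemmas has_derivative_cinner = bounded_bilinear.FDERIV[OF bounded_bilinear_cinner]
lemmas has_derivative_scaleC = bounded_bilinear.FDERIV[OF bounded_bilinear_scaleC]

lemma frechet_derivative_eq: "(f has_derivative f') (at x) \<Longrightarrow> frechet_derivative f (at x) = f'"
  using frechet_derivative_at by metis

text \<open>The metric is read off from the Levi form at \<open>(e, e)\<close> once the latter is known to be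
  sesquilinear on the complex line of \<open>e\<close>.\<close>

lemma kahler_metric_diag:
  assumes "levi_form \<rho> p e (\<i> *\<^sub>C e) = - \<i> * L" "levi_form \<rho> p (\<i> *\<^sub>C e) e = \<i> * L"
  shows "kahler_metric \<rho> p e e = Re L / pi"
  unfolding kahler_metric_def kahler_form_def del_delbar_def assms
  by (simp add: field_simps complex_eq_iff)

lemma has_derivative_ln_norm_sq:
  fixes Z :: "'a::real_inner" assumes "Z \<noteq> 0"
  shows "((\<lambda>x. complex_of_real (ln ((norm x)\<^sup>2))) has_derivative
           (\<lambda>v. complex_of_real (2 * (Z \<bullet> v) / (norm Z)\<^sup>2))) (at Z)"
  unfolding power2_norm_eq_inner using assms
  by (auto intro!: derivative_eq_intros simp: inner_commute divide_inverse algebra_simps)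

lemma delbar_ln_norm_sq:
  fixes Z :: "'a::{complex_normed_vector,real_inner}" assumes "Z \<noteq> 0"
  shows "delbar (\<lambda>x. complex_of_real (ln ((norm x)\<^sup>2))) Z v = cinner Z v / cinner Z Z"
  unfolding delbar_def frechet_derivative_eq[OF has_derivative_ln_norm_sq[OF assms]] cinner_self
  by (simp add: cinner_def complex_eq_iff add_divide_distrib)

lemma levi_form_ln_norm_sq:
  fixes Z :: "'a::{complex_normed_vector,real_inner}" assumes "Z \<noteq> 0"
  shows "levi_form (\<lambda>x. ln ((norm x)\<^sup>2)) Z u v =
           cinner u v / cinner Z Z - cinner u Z * cinner Z v / (cinner Z Z)\<^sup>2"
proof -
  have nz: "cinner Z Z \<noteq> 0" using assms by (simp add: cinner_self)
  have "((\<lambda>q. cinner q v / cinner q q) has_derivative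
      (\<lambda>w. cinner w v / cinner Z Z - cinner Z v * (cinner w Z + cinner Z w) / (cinner Z Z)\<^sup>2)) (at Z)"
    by (rule has_derivative_eq_rhs, rule has_derivative_divide)
       (use nz in \<open>auto intro!: derivative_eq_intros has_derivative_cinner
          simp: bounded_bilinear.zero_right[OF bounded_bilinear_cinner] fun_eq_iff field_simps power2_eq_square\<close>)
  then have "((\<lambda>q. delbar (\<lambda>x. complex_of_real (ln ((norm x)\<^sup>2))) q v) has_derivative
      (\<lambda>w. cinner w v / cinner Z Z - cinner Z v * (cinner w Z + cinner Z w) / (cinner Z Z)\<^sup>2)) (at Z)"
    by (rule has_derivative_transform_within_open[of _ _ _ _ "- {0}"])
       (use assms in \<open>auto simp: delbar_ln_norm_sq\<close>)
  from frechet_derivative_eq[OF this] show ?thesis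
    unfolding levi_form_def del_def
    using nz by (simp add: cinner_scaleC_left cinner_scaleC_right field_simps power2_eq_square)
qed

lemma fs_metric_diag:
  assumes "Z \<noteq> 0"
  shows "fs_metric Z u u = Re (cinner u u / cinner Z Z - cinner u Z * cinner Z u / (cinner Z Z)\<^sup>2) / pi"
  unfolding fs_metric_def
  by (rule kahler_metric_diag)
     (simp_all add: levi_form_ln_norm_sq[OF assms] cinner_scaleC_left cinner_scaleC_right algebra_simps)

section \<open>The Eguchi--Hanson metric on a fibre\<close>

text \<open>The derivative of \<open>eh_u c\<close>, see \<open>DERIV_eh_u\<close>; in it the logarithm has disappeared.\<close>

definition eh_slope :: "real \<Rightarrow> real \<Rightarrow> real" where
  "eh_slope c x = c / (2 * (sqrt (1 + c * x) + 1))"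

lemma DERIV_eh_u:
  assumes "c > 0" "x \<ge> 0"
  shows "(eh_u c has_real_derivative eh_slope c x) (at x)"
proof -
  have pos: "1 + c * x > 0" using assms by (simp add: add_pos_nonneg)
  define g where "g = (\<lambda>x. sqrt (1 + c * x))"
  define s where "s = g x"
  have s: "s > 0" "s + 1 > 0" using pos by (simp_all add: s_def g_def add_pos_pos)
  have "(g has_real_derivative c / (2 * s)) (at x)"
    using pos unfolding g_def by (auto intro!: derivative_eq_intros simp: s_def g_def field_simps)
  then have "(eh_u c has_real_derivative c / (2 * s) - c / (2 * s) / 2 / ((s + 1) / 2)) (at x)"
    unfolding eh_u_def g_def[THEN fun_cong, symmetric] using s
    by (auto intro!: derivative_eq_intros simp flip: s_def)
  moreover have "c / (2 * s) - c / (2 * s) / 2 / ((s + 1) / 2) = eh_slope c x"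
    using s by (simp add: eh_slope_def divide_simps flip: s_def g_def[THEN fun_cong]) (simp add: algebra_simps)
  ultimately show ?thesis by simp
qed

lemma DERIV_eh_slope:
  assumes "c > 0" "x \<ge> 0"
  shows "(eh_slope c has_real_derivative
    - c\<^sup>2 / (4 * sqrt (1 + c * x) * (sqrt (1 + c * x) + 1)\<^sup>2)) (at x)"
proof -
  have pos: "1 + c * x > 0" using assms by (simp add: add_pos_nonneg)
  define g where "g = (\<lambda>x. sqrt (1 + c * x))"
  define s where "s = g x"
  have s: "s > 0" "s + 1 > 0" using pos by (simp_all add: s_def g_def add_pos_pos)
  have "(g has_real_derivative c / (2 * s)) (at x)"
    using pos unfolding g_def by (auto intro!: derivative_eq_intros simp: s_def g_def field_simps)
  then have "(eh_slope c has_real_derivative - (c * (2 * (c / (2 * s)))) / (2 * (s + 1))\<^sup>2) (at x)"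
    unfolding eh_slope_def g_def[THEN fun_cong, symmetric] using s
    by (auto intro!: derivative_eq_intros simp: power2_eq_square simp flip: s_def)
  moreover have "- (c * (2 * (c / (2 * s)))) / (2 * (s + 1))\<^sup>2 = - c\<^sup>2 / (4 * s * (s + 1)\<^sup>2)"
    using s by (simp add: divide_simps power2_eq_square) (simp add: algebra_simps)
  ultimately show ?thesis by (simp add: s_def g_def)
qed

lemma has_derivative_eh_potential:
  assumes "c > 0"
  defines "a \<equiv> \<lambda>q::complex \<times> complex. 1 + fst q \<bullet> fst q"
  shows "((\<lambda>x. complex_of_real (eh_potential c x)) has_derivative
    (\<lambda>v. complex_of_real (2 * (fst q \<bullet> fst v) / a q +
       eh_slope c ((a q)\<^sup>2 * (snd q \<bullet> snd q)) *
       (4 * a q * (fst q \<bullet> fst v) * (snd q \<bullet> snd q) + 2 * (a q)\<^sup>2 * (snd q \<bullet> snd v))))) (at q)"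
proof -
  have a: "a q > 0" by (simp add: a_def add_pos_nonneg)
  define y where "y = (\<lambda>q. (a q)\<^sup>2 * (snd q \<bullet> snd q))"
  have y: "(y has_derivative (\<lambda>v. 4 * a q * (fst q \<bullet> fst v) * (snd q \<bullet> snd q) +
      2 * (a q)\<^sup>2 * (snd q \<bullet> snd v))) (at q)"
    unfolding y_def a_def
    by (auto intro!: derivative_eq_intros simp: fun_eq_iff inner_commute algebra_simps)
  have "y q \<ge> 0" by (simp add: y_def)
  note u = DERIV_eh_u[OF assms(1) this, unfolded has_field_derivative_def]
  have l: "((\<lambda>q. ln (a q)) has_derivative (\<lambda>v. 2 * (fst q \<bullet> fst v) / a q)) (at q)"
    using a unfolding a_def
    by (auto intro!: derivative_eq_intros simp: fun_eq_iff inner_commute field_simps)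
  have "((\<lambda>q. ln (a q) + eh_u c (y q)) has_derivative
     (\<lambda>v. 2 * (fst q \<bullet> fst v) / a q +
       eh_slope c (y q) * (4 * a q * (fst q \<bullet> fst v) * (snd q \<bullet> snd q) +
      2 * (a q)\<^sup>2 * (snd q \<bullet> snd v)))) (at q)"
    by (rule has_derivative_add[OF l has_derivative_compose[OF y u]])
  moreover have "(\<lambda>q. ln (a q) + eh_u c (y q)) = eh_potential c"
    by (simp add: fun_eq_iff eh_potential_def a_def y_def case_prod_unfold power2_norm_eq_inner)
  ultimately show ?thesis
    unfolding y_def by (intro has_derivative_of_real) simp
qed

text \<open>A Levi form along the fibre over 0 differentiates \<open>delbar\<close> of the potential as a function of
  both coordinates, so \<open>delbar\<close> in the fibre direction is computed at all points.\<close>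

lemma delbar_eh_potential:
  assumes "c > 0"
  defines "a \<equiv> \<lambda>q::complex \<times> complex. 1 + fst q \<bullet> fst q"
  shows "delbar (\<lambda>x. complex_of_real (eh_potential c x)) q (0, w) =
    complex_of_real (eh_slope c ((a q)\<^sup>2 * (snd q \<bullet> snd q)) * (a q)\<^sup>2) * snd q * cnj w"
proof -
  have "delbar (\<lambda>x. complex_of_real (eh_potential c x)) q (0, w) =
      complex_of_real (eh_slope c ((a q)\<^sup>2 * (snd q \<bullet> snd q)) * (a q)\<^sup>2) *
      (complex_of_real (snd q \<bullet> w) + \<i> * complex_of_real (snd q \<bullet> (\<i> * w)))"
    unfolding delbar_def frechet_derivative_eq[OF has_derivative_eh_potential[OF assms(1)]] a_def
    by (simp add: scaleC_prod_def scaleC_complex_def algebra_simps)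
  also have "complex_of_real (snd q \<bullet> w) + \<i> * complex_of_real (snd q \<bullet> (\<i> * w)) = snd q * cnj w"
    by (simp add: complex_eq_iff inner_complex_def)
  finally show ?thesis by (simp only: mult.assoc)
qed

lemma levi_form_eh_potential:
  assumes c: "c > 0"
  shows "levi_form (eh_potential c) (0, \<xi>) (0, u) (0, w) =
    complex_of_real (c / (4 * sqrt (1 + c * (norm \<xi>)\<^sup>2))) * u * cnj w"
proof -
  define a where "a = (\<lambda>q::complex \<times> complex. 1 + fst q \<bullet> fst q)"
  define x where "x = (norm \<xi>)\<^sup>2"
  define s where "s = sqrt (1 + c * x)"
  define D where "D = - c\<^sup>2 / (4 * s * (s + 1)\<^sup>2)"
  have x: "x \<ge> 0" by (simp add: x_def)
  have s: "s > 0" "s\<^sup>2 = 1 + c * x" using c x by (simp_all add: s_def add_pos_nonneg)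
  let ?p = "(0, \<xi>) :: complex \<times> complex"
  have y: "((\<lambda>q. (a q)\<^sup>2 * (snd q \<bullet> snd q)) has_derivative (\<lambda>v. 2 * (\<xi> \<bullet> snd v))) (at ?p)"
    unfolding a_def
    by (auto intro!: derivative_eq_intros simp: fun_eq_iff inner_commute algebra_simps)
  have "(eh_slope c has_derivative (*) D) (at ((a ?p)\<^sup>2 * (snd ?p \<bullet> snd ?p)))"
    using DERIV_eh_slope[OF c x]
    by (simp add: a_def has_field_derivative_def D_def s_def x_def power2_norm_eq_inner)
  from has_derivative_compose[OF y this]
  have sl: "((\<lambda>q. eh_slope c ((a q)\<^sup>2 * (snd q \<bullet> snd q))) has_derivative
       (\<lambda>v. D * (2 * (\<xi> \<bullet> snd v)))) (at ?p)" by simp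
  \<comment> \<open>The factor \<open>1 + |z|\<^sup>2\<close> is critical at \<open>z = 0\<close>, so only the fibre coordinate contributes.\<close>
  have aa: "((\<lambda>q. (a q)\<^sup>2) has_derivative (\<lambda>v. 0)) (at ?p)"
    unfolding a_def by (auto intro!: derivative_eq_intros simp: fun_eq_iff)
  have ax: "a ?p = 1" "(a ?p)\<^sup>2 * (snd ?p \<bullet> snd ?p) = x"
    by (simp_all add: a_def x_def power2_norm_eq_inner)
  have "((\<lambda>q. eh_slope c ((a q)\<^sup>2 * (snd q \<bullet> snd q)) * (a q)\<^sup>2) has_derivative
       (\<lambda>v. D * (2 * (\<xi> \<bullet> snd v)))) (at ?p)"
    by (rule has_derivative_eq_rhs, rule has_derivative_mult[OF sl aa])
       (simp add: fun_eq_iff ax(1))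
  note g = has_derivative_of_real[OF this, where 'a = complex]
  have "((\<lambda>q. complex_of_real (eh_slope c ((a q)\<^sup>2 * (snd q \<bullet> snd q)) * (a q)\<^sup>2) * snd q * cnj w)
     has_derivative (\<lambda>v. (complex_of_real (eh_slope c x) * snd v +
         complex_of_real (D * (2 * (\<xi> \<bullet> snd v))) * \<xi>) * cnj w)) (at ?p)"
    by (rule has_derivative_eq_rhs,
        rule has_derivative_mult_left[OF has_derivative_mult[OF g has_derivative_snd[OF has_derivative_ident]]])
       (simp only: ax(2), simp add: ax(1))
  then have "((\<lambda>q. delbar (\<lambda>x. complex_of_real (eh_potential c x)) q (0, w))
     has_derivative (\<lambda>v. (complex_of_real (eh_slope c x) * snd v +
         complex_of_real (D * (2 * (\<xi> \<bullet> snd v))) * \<xi>) * cnj w)) (at ?p)"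
    by (simp add: delbar_eh_potential[OF c] a_def)
  from frechet_derivative_eq[OF this]
  have "levi_form (eh_potential c) ?p (0, u) (0, w) =
     (eh_slope c x * u + D * (complex_of_real (\<xi> \<bullet> u) - \<i> * complex_of_real (\<xi> \<bullet> (\<i> * u))) * \<xi>) * cnj w"
    by (simp add: levi_form_def del_def scaleC_prod_def scaleC_complex_def field_simps)
  also have "complex_of_real (\<xi> \<bullet> u) - \<i> * complex_of_real (\<xi> \<bullet> (\<i> * u)) = u * cnj \<xi>"
    by (simp add: complex_eq_iff inner_complex_def)
  also have "(eh_slope c x * u + D * (u * cnj \<xi>) * \<xi>) = complex_of_real (eh_slope c x + D * x) * u"
    using complex_norm_square[of \<xi>] by (simp add: x_def algebra_simps)
  \<comment> \<open>This is \<open>(x u'(x))'\<close>, where \<open>x u'(x) = (s - 1) / 2\<close>.\<close>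
  also have "eh_slope c x + D * x = c / (4 * s)"
  proof -
    have "s + 1 \<noteq> 0" using s by linarith
    have "D * x = - (c * (c * x)) / (4 * s * (s + 1)\<^sup>2)"
      by (simp add: D_def power2_eq_square mult_ac)
    also have "c * x = (s - 1) * (s + 1)" using s by (simp add: power2_eq_square algebra_simps)
    finally have Dx: "D * x = - (c * ((s - 1) * (s + 1))) / (4 * s * (s + 1)\<^sup>2)" .
    show ?thesis using s(1) \<open>s + 1 \<noteq> 0\<close>
      unfolding eh_slope_def s_def[symmetric] Dx
      by (simp add: divide_simps) (simp add: power2_eq_square algebra_simps)
  qed
  finally show ?thesis by (simp add: s_def x_def)
qed

lemma eh_metric_fibre:
  assumes c: "c > 0"
  shows "eh_metric c i (0, \<xi>) (0, 1) (0, 1) = c / (4 * sqrt (1 + c * (norm \<xi>)\<^sup>2)) / pi"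
proof -
  have "kahler_metric (eh_potential c) (0, \<xi>) (0, 1) (0, 1)
      = Re (complex_of_real (c / (4 * sqrt (1 + c * (norm \<xi>)\<^sup>2)))) / pi"
    by (rule kahler_metric_diag)
       (simp_all add: scaleC_prod_def scaleC_complex_def levi_form_eh_potential[OF c])
  then show ?thesis by (simp add: eh_metric_def)
qed

section \<open>Holomorphic maps into the sequence space\<close>

lemma norm_l2_coord_le: "cmod (l2_coord x i) \<le> norm x"
proof -
  have "(\<Sum>j\<in>{i}. (cmod (l2_coord x j))\<^sup>2) \<le> (norm x)\<^sup>2"
    unfolding norm_l2_sq by (intro sum_le_suminf l2_summable) auto
  then show ?thesis by (simp add: power2_le_iff_abs_le)
qed

lemma bounded_linear_l2_coord: "bounded_linear (\<lambda>x. l2_coord x i)"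
  by (rule bounded_linear_intro[of _ 1])
     (simp_all add: plus_l2.rep_eq scaleR_l2.rep_eq norm_l2_coord_le)

lemma norm_sum_l2_coord_le:
  "cmod (\<Sum>i<n. c i * l2_coord x i) \<le> norm x * sqrt (\<Sum>i<n. (cmod (c i))\<^sup>2)"
proof -
  have "cmod (\<Sum>i<n. c i * l2_coord x i) \<le> (\<Sum>i<n. \<bar>cmod (c i)\<bar> * \<bar>cmod (l2_coord x i)\<bar>)"
    using norm_sum[of "\<lambda>i. c i * l2_coord x i" "{..<n}"] by (simp add: norm_mult)
  also have "\<dots> \<le> sqrt (\<Sum>i<n. (cmod (c i))\<^sup>2) * sqrt (\<Sum>i<n. (cmod (l2_coord x i))\<^sup>2)"
    using L2_set_mult_ineq[of "\<lambda>i. cmod (c i)" "\<lambda>i. cmod (l2_coord x i)" "{..<n}"]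
    by (simp only: L2_set_def)
  also have "(\<Sum>i<n. (cmod (l2_coord x i))\<^sup>2) \<le> (norm x)\<^sup>2"
    unfolding norm_l2_sq by (intro sum_le_suminf l2_summable) auto
  then have "sqrt (\<Sum>i<n. (cmod (c i))\<^sup>2) * sqrt (\<Sum>i<n. (cmod (l2_coord x i))\<^sup>2)
      \<le> sqrt (\<Sum>i<n. (cmod (c i))\<^sup>2) * norm x"
    by (intro mult_left_mono real_le_lsqrt) (auto simp: sum_nonneg)
  finally show ?thesis by (simp only: mult.commute)
qed

text \<open>Testing with \<open>c\<^sub>i = cnj a\<^sub>i\<close> turns a bound for all finite linear combinations into the bound
  \<open>S \<le> K sqrt S\<close> for the partial sums \<open>S\<close> of \<open>|a\<^sub>i|\<^sup>2\<close>. In this way scalar estimates that are linear in a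
  holomorphic function become norm estimates for sequence-valued maps.\<close>

lemma l2_of_bounded_functional:
  assumes K: "\<And>n c. cmod (\<Sum>i<n. c i * a i) \<le> K * sqrt (\<Sum>i<n. (cmod (c i))\<^sup>2)" and "K \<ge> 0"
  shows "\<exists>x. l2_coord x = a \<and> norm x \<le> K"
proof -
  have S: "(\<Sum>i<n. (cmod (a i))\<^sup>2) \<le> K\<^sup>2" for n
  proof -
    define S where "S = (\<Sum>i<n. (cmod (a i))\<^sup>2)"
    have S0: "S \<ge> 0" by (simp add: S_def sum_nonneg)
    have "(\<Sum>i<n. cnj (a i) * a i) = complex_of_real S"
      unfolding S_def of_real_sum
      by (intro sum.cong) (simp_all add: complex_norm_square mult.commute del: of_real_power)
    with K[where c = "\<lambda>i. cnj (a i)" and n = n] have "cmod (complex_of_real S) \<le> K * sqrt S"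
      by (simp only: S_def complex_mod_cnj)
    with S0 have "S \<le> K * sqrt S" by simp
    then have "sqrt S * sqrt S \<le> K * sqrt S" using S0 by simp
    then have "sqrt S \<le> K" using S0 \<open>K \<ge> 0\<close>
      by (metis less_eq_real_def mult_right_le_imp_le real_sqrt_gt_0_iff real_sqrt_zero)
    then show ?thesis using S0 by (simp add: S_def sqrt_le_D)
  qed
  then have sm: "summable (\<lambda>i. (cmod (a i))\<^sup>2)"
    by (intro summableI_nonneg_bounded) auto
  then have x: "l2_coord (Abs_l2 a) = a" by (simp add: Abs_l2_inverse)
  have "(norm (Abs_l2 a))\<^sup>2 \<le> K\<^sup>2"
    unfolding norm_l2_sq x by (rule suminf_le_const[OF sm S])
  then have "norm (Abs_l2 a) \<le> K"
    using \<open>K \<ge> 0\<close> by (simp add: power2_le_iff_abs_le)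
  with x show ?thesis by blast
qed

lemma deriv_taylor_bound:
  assumes hol: "h holomorphic_on S" "open S" and R: "R > 0" "cball z R \<subseteq> S"
    and B: "\<And>x. x \<in> cball z R \<Longrightarrow> cmod (h x) \<le> B"
  shows "cmod ((deriv ^^ 2) h z) \<le> 2 * B / R\<^sup>2"
    and "y \<in> ball z (R / 2) \<Longrightarrow>
      cmod (deriv h y - deriv h z - (y - z) * (deriv ^^ 2) h z) \<le> 6 * B / (R / 2) ^ 3 * (cmod (y - z))\<^sup>2"
proof -
  have est: "cmod ((deriv ^^ n) h x) \<le> fact n * B / r ^ n" if "r > 0" "cball x r \<subseteq> cball z R" for n x r
  proof (rule Cauchy_inequality)
    show "h holomorphic_on ball x r"
      using hol(1) R that ball_subset_cball by (meson holomorphic_on_subset order_trans)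
    show "continuous_on (cball x r) h"
      using hol(1) R that by (meson holomorphic_on_imp_continuous_on continuous_on_subset order_trans)
    show "cmod (h y) \<le> B" if "cmod (x - y) = r" for y
      using that \<open>cball x r \<subseteq> cball z R\<close> by (intro B) (auto simp: dist_norm)
  qed (use that in auto)
  show "cmod ((deriv ^^ 2) h z) \<le> 2 * B / R\<^sup>2"
    using est[of R z 2] R by (simp add: fact_2)
  assume y: "y \<in> ball z (R / 2)"
  define f where "f = (\<lambda>i. (deriv ^^ Suc i) h)"
  have sub: "ball z (R / 2) \<subseteq> S" using R by auto
  have "cmod (f 0 y - (\<Sum>i\<le>1. f i z * (y - z) ^ i / fact i))
      \<le> (6 * B / (R / 2) ^ 3) * cmod (y - z) ^ Suc 1 / fact 1"
  proof (rule field_Taylor)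
    show "convex (ball z (R / 2))" by simp
    show "(f i has_field_derivative f (Suc i) x) (at x within ball z (R / 2))"
      if "x \<in> ball z (R / 2)" for i x
      unfolding f_def
      by (rule has_field_derivative_at_within, rule has_field_derivative_higher_deriv[OF hol])
         (use that sub in auto)
    show "cmod (f (Suc 1) x) \<le> 6 * B / (R / 2) ^ 3" if "x \<in> ball z (R / 2)" for x
    proof -
      have "cball x (R / 2) \<subseteq> cball z R"
      proof
        fix u assume "u \<in> cball x (R / 2)"
        with that dist_triangle[of z u x] show "u \<in> cball z R" by simp
      qed
      from est[of "R/2" x 3, OF _ this] R show ?thesis
        by (simp add: f_def fact_numeral numeral_3_eq_3)
    qed
  qed (use y R in auto)
  then show "cmod (deriv h y - deriv h z - (y - z) * (deriv ^^ 2) h z)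
      \<le> 6 * B / (R / 2) ^ 3 * (cmod (y - z))\<^sup>2"
    by (simp add: f_def power2_eq_square numeral_2_eq_2 algebra_simps)
qed

lemma higher_deriv_comb:
  assumes "\<And>i. f i holomorphic_on S" "open S" "z \<in> S"
  shows "(deriv ^^ k) (\<lambda>z. \<Sum>i<n. c i * f i z) z = (\<Sum>i<(n::nat). c i * (deriv ^^ k) (f i) z)"
  using assms(3)
proof (induction k arbitrary: z)
  case (Suc k)
  have "((\<lambda>z. \<Sum>i<n. c i * (deriv ^^ k) (f i) z) has_field_derivative
      (\<Sum>i<n. c i * (deriv ^^ Suc k) (f i) z)) (at z)"
    by (intro DERIV_sum DERIV_cmult has_field_derivative_higher_deriv[OF assms(1,2) Suc.prems])
  then have "((deriv ^^ k) (\<lambda>z. \<Sum>i<n. c i * f i z) has_field_derivative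
      (\<Sum>i<n. c i * (deriv ^^ Suc k) (f i) z)) (at z)"
    by (rule has_field_derivative_transform_within_open[OF _ assms(2) Suc.prems]) (simp add: Suc.IH)
  then show ?case by (simp add: DERIV_imp_deriv)
qed simp

text \<open>For coefficients \<open>c\<close>, the scalar function \<open>h = \<Sum> c\<^sub>i F\<^sub>i\<close> is bounded by \<open>M |c|\<close>, where \<open>M\<close>
  bounds \<open>|F|\<close> on a disc. Cauchy's estimates for \<open>h''\<close> and for the Taylor remainder of \<open>h'\<close> are
  therefore proportional to \<open>|c|\<close>: the first shows that the second derivatives of the coordinates are
  square summable, the second that they form the derivative of \<open>F1\<close> in norm.\<close>

lemma l2_derivative_has_derivative:
  fixes F F1 :: "complex \<Rightarrow> l2"
  assumes S: "open S" and F: "\<And>z. z \<in> S \<Longrightarrow> (F has_derivative (\<lambda>w. w *\<^sub>C F1 z)) (at z)"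
  shows "\<exists>F2. \<forall>z\<in>S. (F1 has_derivative (\<lambda>w. w *\<^sub>C F2 z)) (at z)"
proof -
  define f where "f = (\<lambda>i z. l2_coord (F z) i)"
  have f': "(f i has_field_derivative l2_coord (F1 z) i) (at z)" if "z \<in> S" for i z
    using bounded_linear.has_derivative[OF bounded_linear_l2_coord F[OF that], of i]
    by (simp add: f_def scaleC_l2.rep_eq has_field_derivative_def mult_commute_abs)
  then have hol: "f i holomorphic_on S" for i
    using S by (auto simp: holomorphic_on_open)
  have f1: "deriv (f i) z = l2_coord (F1 z) i" if "z \<in> S" for i z
    using f'[OF that] by (rule DERIV_imp_deriv)
  have "\<exists>v. (F1 has_derivative (\<lambda>w. w *\<^sub>C v)) (at z)" if z: "z \<in> S" for z
  proof -
    obtain R where R: "R > 0" "cball z R \<subseteq> S"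
      using S z open_contains_cball by blast
    have "continuous_on (cball z R) F"
      using F R has_derivative_continuous by (intro continuous_at_imp_continuous_on) blast
    then have "compact (F ` cball z R)" by (intro compact_continuous_image) auto
    then obtain M where M: "M > 0" "\<And>x. x \<in> cball z R \<Longrightarrow> norm (F x) \<le> M"
      using compact_imp_bounded bounded_pos by (metis image_eqI)
    define h where "h = (\<lambda>n (c :: nat \<Rightarrow> complex) z. \<Sum>i<n. c i * f i z)"
    have h: "h n c holomorphic_on S" for n c
      unfolding h_def by (intro holomorphic_intros hol)
    have hB: "cmod (h n c x) \<le> M * sqrt (\<Sum>i<n. (cmod (c i))\<^sup>2)" if "x \<in> cball z R" for n c x
      unfolding h_def f_def
      by (rule order_trans[OF norm_sum_l2_coord_le])
         (intro mult_right_mono M that real_sqrt_ge_zero sum_nonneg zero_le_power2)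
    have hd: "(deriv ^^ k) (h n c) x = (\<Sum>i<n. c i * (deriv ^^ k) (f i) x)" if "x \<in> S" for k n c x
      unfolding h_def by (rule higher_deriv_comb[OF hol S that])
    have "cmod (\<Sum>i<n. c i * (deriv ^^ 2) (f i) z) \<le> (2 * M / R\<^sup>2) * sqrt (\<Sum>i<n. (cmod (c i))\<^sup>2)"
      for n c
      using deriv_taylor_bound(1)[OF h S R hB] z by (simp add: hd mult.assoc)
    from l2_of_bounded_functional[OF this] M(1) obtain v where
      v: "l2_coord v = (\<lambda>i. (deriv ^^ 2) (f i) z)" by auto
    define K where "K = 6 * M / (R / 2) ^ 3"
    have K0: "K \<ge> 0" using M R by (simp add: K_def)
    have bound: "norm (F1 y - F1 z - (y - z) *\<^sub>C v) \<le> K * (cmod (y - z))\<^sup>2"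
      if y: "y \<in> ball z (R / 2)" for y
    proof -
      define a where "a = (\<lambda>i. deriv (f i) y - deriv (f i) z - (y - z) * (deriv ^^ 2) (f i) z)"
      have yS: "y \<in> S" using y R by auto
      have "cmod (\<Sum>i<n. c i * a i) \<le> (K * (cmod (y - z))\<^sup>2) * sqrt (\<Sum>i<n. (cmod (c i))\<^sup>2)" for n c
      proof -
        have "(\<Sum>i<n. c i * a i)
            = deriv (h n c) y - deriv (h n c) z - (y - z) * (deriv ^^ 2) (h n c) z"
          using hd[OF yS, of 1] hd[OF z, of 1] hd[OF z, of 2]
          by (simp add: a_def algebra_simps sum.distrib sum_subtractf sum_distrib_left)
        with deriv_taylor_bound(2)[OF h S R hB y] show ?thesis
          by (simp add: K_def mult_ac)
      qed
      from l2_of_bounded_functional[OF this] K0 obtain x where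
        x: "l2_coord x = a" "norm x \<le> K * (cmod (y - z))\<^sup>2" by auto
      have "x = F1 y - F1 z - (y - z) *\<^sub>C v"
        by (rule l2_eqI) (simp add: x a_def minus_l2.rep_eq scaleC_l2.rep_eq v f1 yS z)
      with x show ?thesis by simp
    qed
    have "(F1 has_derivative (\<lambda>w. w *\<^sub>C v)) (at z)"
    proof (rule has_derivativeI_sandwich[where H = "\<lambda>y. K * cmod (y - z)"])
      show "0 < R / 2" using R by simp
      show "bounded_linear (\<lambda>w. w *\<^sub>C v)"
        by (rule bounded_bilinear.bounded_linear_left[OF bounded_bilinear_scaleC])
      show "norm (F1 y - F1 z - (y - z) *\<^sub>C v) / norm (y - z) \<le> K * cmod (y - z)"
        if "y \<noteq> z" "dist y z < R / 2" for y
        using bound[of y] that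
        by (simp add: divide_le_eq power2_eq_square mult.assoc dist_commute)
      show "((\<lambda>y. K * cmod (y - z)) \<longlongrightarrow> 0) (at z)"
        by (auto intro!: tendsto_eq_intros)
    qed
    then show ?thesis by blast
  qed
  then show ?thesis by metis
qed

section \<open>Norms that are radial functions\<close>

lemma linear_antilinear_unique:
  assumes "\<And>w. a * w + b * cnj w = a' * w + b' * cnj w"
  shows "a = a'" "b = b'"
proof -
  have 1: "a + b = a' + b'" using assms[of 1] by simp
  have "\<i> * (a - b) = \<i> * (a' - b')" using assms[of \<i>] by (simp add: algebra_simps)
  then have 2: "a - b = a' - b'" by simp
  show "a = a'" "b = b'" using 1 2 by (simp_all add: complex_eq_iff)
qed

lemma has_derivative_radial:
  assumes "(\<phi> has_field_derivative d) (at (\<xi> * cnj \<xi>))"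
  shows "((\<lambda>\<xi>. \<phi> (\<xi> * cnj \<xi>)) has_derivative (\<lambda>w. d * (cnj \<xi> * w + \<xi> * cnj w))) (at \<xi>)"
proof -
  have "((\<lambda>\<xi>. \<xi> * cnj \<xi>) has_derivative (\<lambda>w. cnj \<xi> * w + \<xi> * cnj w)) (at \<xi>)"
    by (auto intro!: derivative_eq_intros simp: fun_eq_iff algebra_simps)
  from has_derivative_compose[OF this assms[unfolded has_field_derivative_def]]
  show ?thesis .
qed

lemma has_derivative_cinner_holo:
  assumes "(F has_derivative (\<lambda>w. w *\<^sub>C F1)) (at \<xi>)" "(G has_derivative (\<lambda>w. w *\<^sub>C G1)) (at \<xi>)"
  shows "((\<lambda>\<xi>. cinner (F \<xi>) (G \<xi>)) has_derivative
      (\<lambda>w. cinner F1 (G \<xi>) * w + cinner (F \<xi>) G1 * cnj w)) (at \<xi>)"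
  by (rule has_derivative_eq_rhs[OF has_derivative_cinner[OF assms]])
     (simp add: fun_eq_iff cinner_scaleC_left cinner_scaleC_right mult.commute add.commute)

text \<open>The operator \<open>\<partial>\<^sup>2 / \<partial>\<xi> \<partial>(cnj \<xi>)\<close> sends the function \<open>\<phi>(|\<xi>|\<^sup>2)\<close> to \<open>\<psi>(|\<xi>|\<^sup>2)\<close> with
  \<open>\<psi>(x) = (x \<phi>'(x))'\<close>.\<close>

definition radial_laplacian :: "(complex \<Rightarrow> complex) \<Rightarrow> complex \<Rightarrow> complex" where
  "radial_laplacian \<phi> x = deriv \<phi> x + x * deriv (deriv \<phi>) x"

lemma holomorphic_radial_laplacian:
  "\<phi> holomorphic_on T \<Longrightarrow> open T \<Longrightarrow> radial_laplacian \<phi> holomorphic_on T"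
  unfolding radial_laplacian_def by (intro holomorphic_intros)

lemma higher_deriv_radial_laplacian:
  assumes "\<phi> holomorphic_on T" "open T" "x \<in> T"
  shows "(deriv ^^ j) (radial_laplacian \<phi>) x =
    of_nat (Suc j) * (deriv ^^ Suc j) \<phi> x + x * (deriv ^^ Suc (Suc j)) \<phi> x"
  using assms(3)
proof (induction j arbitrary: x)
  case 0
  then show ?case by (simp add: radial_laplacian_def)
next
  case (Suc j)
  note D = has_field_derivative_higher_deriv[OF assms(1,2) Suc.prems]
  have "((\<lambda>x. of_nat (Suc j) * (deriv ^^ Suc j) \<phi> x + x * (deriv ^^ Suc (Suc j)) \<phi> x)
     has_field_derivative of_nat (Suc j) * (deriv ^^ Suc (Suc j)) \<phi> x +
       (1 * (deriv ^^ Suc (Suc j)) \<phi> x + (deriv ^^ Suc (Suc (Suc j))) \<phi> x * x)) (at x)"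
    by (intro DERIV_add DERIV_cmult DERIV_mult D DERIV_ident)
  then have "((deriv ^^ j) (radial_laplacian \<phi>)
     has_field_derivative of_nat (Suc j) * (deriv ^^ Suc (Suc j)) \<phi> x +
       (1 * (deriv ^^ Suc (Suc j)) \<phi> x + (deriv ^^ Suc (Suc (Suc j))) \<phi> x * x)) (at x)"
    by (rule has_field_derivative_transform_within_open[OF _ assms(2) Suc.prems])
       (simp only: Suc.IH)
  from DERIV_imp_deriv[OF this] show ?case
    by (simp add: algebra_simps)
qed

text \<open>On monomials, \<open>(x (x\<^sup>k)')' = k\<^sup>2 x\<^sup>k\<^sup>-\<^sup>1\<close>; hence \<open>k\<close> applications leave \<open>(k!)\<^sup>2\<close> times the
  \<open>k\<close>-th Taylor coefficient at 0. The statement with \<open>j\<close> further derivatives is what the induction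
  needs.\<close>

lemma iterated_radial_laplacian_0:
  assumes "\<phi> holomorphic_on T" "open T" "0 \<in> T"
  shows "(deriv ^^ j) ((radial_laplacian ^^ k) \<phi>) 0 =
    fact (j + k) / fact j * (deriv ^^ (j + k)) \<phi> 0"
  using assms(1)
proof (induction k arbitrary: \<phi>)
  case (Suc k)
  have "(deriv ^^ j) ((radial_laplacian ^^ Suc k) \<phi>) 0
      = (deriv ^^ j) ((radial_laplacian ^^ k) (radial_laplacian \<phi>)) 0"
    by (simp add: funpow_swap1)
  also have "\<dots> = fact (j + k) / fact j * (of_nat (Suc (j + k)) * (deriv ^^ Suc (j + k)) \<phi> 0)"
    using Suc.IH[OF holomorphic_radial_laplacian[OF Suc.prems assms(2)]]
      higher_deriv_radial_laplacian[OF Suc.prems assms(2,3)]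
    by simp
  finally show ?case by (simp add: fact_Suc mult_ac)
qed simp

text \<open>Since \<open>G\<close> is holomorphic, \<open>\<partial> / \<partial>\<xi>\<close> acts on the first factor of \<open>\<langle>G, G\<rangle>\<close> only and
  \<open>\<partial> / \<partial>(cnj \<xi>)\<close> on the second only, so the mixed derivative of \<open>|G|\<^sup>2\<close> is \<open>|G'|\<^sup>2\<close>. The two partial
  derivatives are separated by \<open>linear_antilinear_unique\<close>.\<close>

lemma cinner_derivative_radial:
  assumes r: "open S" and T: "open T" "\<phi> holomorphic_on T"
    and ST: "\<And>\<xi>. \<xi> \<in> S \<Longrightarrow> \<xi> * cnj \<xi> \<in> T"
    and G: "\<And>\<xi>. \<xi> \<in> S \<Longrightarrow> (G has_derivative (\<lambda>w. w *\<^sub>C G1 \<xi>)) (at \<xi>)"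
    and G1: "\<And>\<xi>. \<xi> \<in> S \<Longrightarrow> (G1 has_derivative (\<lambda>w. w *\<^sub>C G2 \<xi>)) (at \<xi>)"
    and eq: "\<And>\<xi>. \<xi> \<in> S \<Longrightarrow> cinner (G \<xi>) (G \<xi>) = \<phi> (\<xi> * cnj \<xi>)"
    and \<xi>: "\<xi> \<in> S"
  shows "cinner (G1 \<xi>) (G1 \<xi>) = radial_laplacian \<phi> (\<xi> * cnj \<xi>)"
proof -
  have d\<phi>: "(\<phi> has_field_derivative deriv \<phi> x) (at x)" if "x \<in> T" for x
    using T that by (simp add: holomorphic_derivI)
  have d2\<phi>: "(deriv \<phi> has_field_derivative deriv (deriv \<phi>) x) (at x)" if "x \<in> T" for x
    by (rule holomorphic_derivI[OF holomorphic_deriv[OF T(2,1)] T(1) that])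
  have one: "cinner (G1 \<xi>) (G \<xi>) = deriv \<phi> (\<xi> * cnj \<xi>) * cnj \<xi>" if \<xi>: "\<xi> \<in> S" for \<xi>
  proof -
    have "((\<lambda>\<xi>. cinner (G \<xi>) (G \<xi>)) has_derivative
        (\<lambda>w. deriv \<phi> (\<xi> * cnj \<xi>) * (cnj \<xi> * w + \<xi> * cnj w))) (at \<xi>)"
      by (rule has_derivative_transform_within_open[OF has_derivative_radial[OF d\<phi>[OF ST[OF \<xi>]]] r \<xi>])
         (simp add: eq)
    note fun_cong[OF has_derivative_unique[OF this has_derivative_cinner_holo[OF G G, OF \<xi> \<xi>]]]
    then show ?thesis
      by - (rule linear_antilinear_unique(1)[of _ "cinner (G \<xi>) (G1 \<xi>)" _ "deriv \<phi> (\<xi> * cnj \<xi>) * \<xi>"],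
         simp add: algebra_simps)
  qed
  have "((\<lambda>\<xi>. deriv \<phi> (\<xi> * cnj \<xi>) * cnj \<xi>) has_derivative
     (\<lambda>w. deriv \<phi> (\<xi> * cnj \<xi>) * cnj w + deriv (deriv \<phi>) (\<xi> * cnj \<xi>) * (cnj \<xi> * w + \<xi> * cnj w) * cnj \<xi>)) (at \<xi>)"
    by (intro has_derivative_mult has_derivative_radial d2\<phi> ST \<xi> has_derivative_cnj has_derivative_ident)
  then have "((\<lambda>\<xi>. cinner (G1 \<xi>) (G \<xi>)) has_derivative
     (\<lambda>w. deriv \<phi> (\<xi> * cnj \<xi>) * cnj w + deriv (deriv \<phi>) (\<xi> * cnj \<xi>) * (cnj \<xi> * w + \<xi> * cnj w) * cnj \<xi>)) (at \<xi>)"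
    by (rule has_derivative_transform_within_open[OF _ r \<xi>]) (simp add: one)
  note fun_cong[OF has_derivative_unique[OF this has_derivative_cinner_holo[OF G1 G, OF \<xi> \<xi>]]]
  then have "cinner (G1 \<xi>) (G1 \<xi>) = deriv \<phi> (\<xi> * cnj \<xi>) + \<xi> * deriv (deriv \<phi>) (\<xi> * cnj \<xi>) * cnj \<xi>"
    by - (rule linear_antilinear_unique(2)[of "cinner (G2 \<xi>) (G \<xi>)" _ "deriv (deriv \<phi>) (\<xi> * cnj \<xi>) * cnj \<xi> * cnj \<xi>"],
       simp add: algebra_simps)
  then show ?thesis by (simp add: radial_laplacian_def mult_ac)
qed

text \<open>Iterating \<open>cinner_derivative_radial\<close> gives \<open>|G\<^sup>(\<^sup>k\<^sup>)|\<^sup>2\<close> as the \<open>k\<close>-fold radial Laplacian of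
  \<open>\<phi>\<close>, whose value at 0 is \<open>k!\<close> times the \<open>k\<close>-th derivative of \<open>\<phi>\<close>.\<close>

lemma taylor_coefficients_nonneg:
  fixes G G1 :: "complex \<Rightarrow> l2"
  assumes r: "open S" "0 \<in> S" and T: "open T" "\<phi> holomorphic_on T"
    and ST: "\<And>\<xi>. \<xi> \<in> S \<Longrightarrow> \<xi> * cnj \<xi> \<in> T"
    and G: "\<And>\<xi>. \<xi> \<in> S \<Longrightarrow> (G has_derivative (\<lambda>w. w *\<^sub>C G1 \<xi>)) (at \<xi>)"
    and eq: "\<And>\<xi>. \<xi> \<in> S \<Longrightarrow> cinner (G \<xi>) (G \<xi>) = \<phi> (\<xi> * cnj \<xi>)"
  shows "(deriv ^^ k) \<phi> 0 \<in> \<real>\<^sub>\<ge>\<^sub>0"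
proof -
  have T0: "0 \<in> T" using ST[OF r(2)] by simp
  have hol: "(radial_laplacian ^^ k) \<phi> holomorphic_on T" for k
    by (induction k) (auto intro: holomorphic_radial_laplacian T)
  have "\<exists>G G1 :: complex \<Rightarrow> l2. \<forall>\<xi>\<in>S. (G has_derivative (\<lambda>w. w *\<^sub>C G1 \<xi>)) (at \<xi>) \<and>
      cinner (G \<xi>) (G \<xi>) = (radial_laplacian ^^ k) \<phi> (\<xi> * cnj \<xi>)" for k
  proof (induction k)
    case 0
    with G eq show ?case by auto
  next
    case (Suc k)
    then obtain G G1 :: "complex \<Rightarrow> l2" where
      G: "\<And>\<xi>. \<xi> \<in> S \<Longrightarrow> (G has_derivative (\<lambda>w. w *\<^sub>C G1 \<xi>)) (at \<xi>)"
      and eq: "\<And>\<xi>. \<xi> \<in> S \<Longrightarrow> cinner (G \<xi>) (G \<xi>) = (radial_laplacian ^^ k) \<phi> (\<xi> * cnj \<xi>)" by blast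
    obtain G2 where G2: "\<And>\<xi>. \<xi> \<in> S \<Longrightarrow> (G1 has_derivative (\<lambda>w. w *\<^sub>C G2 \<xi>)) (at \<xi>)"
      using l2_derivative_has_derivative[OF r(1) G] by blast
    have "cinner (G1 \<xi>) (G1 \<xi>) = (radial_laplacian ^^ Suc k) \<phi> (\<xi> * cnj \<xi>)" if "\<xi> \<in> S" for \<xi>
      using cinner_derivative_radial[OF r(1) T(1) hol ST G G2 eq that] by simp
    with G2 show ?case by blast
  qed
  then obtain G :: "complex \<Rightarrow> l2" where
    "\<And>\<xi>. \<xi> \<in> S \<Longrightarrow> cinner (G \<xi>) (G \<xi>) = (radial_laplacian ^^ k) \<phi> (\<xi> * cnj \<xi>)" by blast
  from this[OF r(2)] obtain v :: l2 where v: "cinner v v = (radial_laplacian ^^ k) \<phi> 0" by simp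
  then have "complex_of_real ((norm v)\<^sup>2) = fact k * (deriv ^^ k) \<phi> 0"
    using iterated_radial_laplacian_0[OF T(2,1) T0, of 0 k] by (simp add: cinner_self)
  then have "(deriv ^^ k) \<phi> 0 = complex_of_real ((norm v)\<^sup>2 / fact k)"
    by (simp add: field_simps)
  then show ?thesis by (simp only: nonneg_Reals_of_real_iff) simp
qed

text \<open>The last hypothesis says that \<open>log |F|\<^sup>2\<close> and \<open>log f(|\<xi>|\<^sup>2)\<close> have the same mixed
  derivative \<open>\<partial>\<^sup>2 / \<partial>\<xi> \<partial>(cnj \<xi>)\<close>; here \<open>k\<close> is the logarithmic derivative of \<open>f\<close>. Thus the difference
  \<open>\<psi>\<close> of their \<open>\<partial> / \<partial>\<xi>\<close>-derivatives is holomorphic. If \<open>h\<close> is a primitive of \<open>\<psi>\<close>, then passing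
  from \<open>F\<close> to \<open>e\<^sup>-\<^sup>h F\<close> subtracts \<open>\<psi>\<close> from the first of them, and the quotient of \<open>|e\<^sup>-\<^sup>h F|\<^sup>2\<close> by \<open>f(|\<xi>|\<^sup>2)\<close> has
  derivative 0.\<close>

lemma holomorphic_normalization:
  fixes F F1 :: "complex \<Rightarrow> l2"
  assumes r: "r > 0" and T: "open T" "k holomorphic_on T"
    and ST: "\<And>\<xi>. \<xi> \<in> ball 0 r \<Longrightarrow> \<xi> * cnj \<xi> \<in> T"
    and f: "\<And>x. x \<in> T \<Longrightarrow> (f has_field_derivative k x * f x) (at x)" "\<And>x. x \<in> T \<Longrightarrow> f x \<noteq> 0"
    and k: "\<And>\<xi>. \<xi> \<in> ball 0 r \<Longrightarrow> k (\<xi> * cnj \<xi>) \<in> \<real>"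
    and F: "\<And>\<xi>. \<xi> \<in> ball 0 r \<Longrightarrow> (F has_derivative (\<lambda>w. w *\<^sub>C F1 \<xi>)) (at \<xi>)"
    and F0: "\<And>\<xi>. \<xi> \<in> ball 0 r \<Longrightarrow> F \<xi> \<noteq> 0"
    and eq: "\<And>\<xi>. \<xi> \<in> ball 0 r \<Longrightarrow>
      cinner (F1 \<xi>) (F1 \<xi>) / cinner (F \<xi>) (F \<xi>) -
      cinner (F1 \<xi>) (F \<xi>) * cinner (F \<xi>) (F1 \<xi>) / (cinner (F \<xi>) (F \<xi>))\<^sup>2
      = k (\<xi> * cnj \<xi>) + \<xi> * cnj \<xi> * deriv k (\<xi> * cnj \<xi>)"
  shows "\<exists>(G :: complex \<Rightarrow> l2) G1 C. C \<noteq> 0 \<and> (\<forall>\<xi>\<in>ball 0 r.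
     (G has_derivative (\<lambda>w. w *\<^sub>C G1 \<xi>)) (at \<xi>) \<and> cinner (G \<xi>) (G \<xi>) = C * f (\<xi> * cnj \<xi>))"
proof -
  obtain F2 where F2: "\<And>\<xi>. \<xi> \<in> ball 0 r \<Longrightarrow> (F1 has_derivative (\<lambda>w. w *\<^sub>C F2 \<xi>)) (at \<xi>)"
    using l2_derivative_has_derivative[OF open_ball F] by blast
  define \<psi> where "\<psi> = (\<lambda>\<xi>. cinner (F1 \<xi>) (F \<xi>) / cinner (F \<xi>) (F \<xi>) - k (\<xi> * cnj \<xi>) * cnj \<xi>)"
  have "\<exists>d. (\<psi> has_field_derivative d) (at \<xi>)" if \<xi>: "\<xi> \<in> ball 0 r" for \<xi>
  proof -
    have N: "cinner (F \<xi>) (F \<xi>) \<noteq> 0" using F0[OF \<xi>] by (simp add: cinner_self)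
    have dk: "(k has_field_derivative deriv k (\<xi> * cnj \<xi>)) (at (\<xi> * cnj \<xi>))"
      using T ST[OF \<xi>] by (simp add: holomorphic_derivI)
    define N where "N = cinner (F \<xi>) (F \<xi>)"
    define A where "A = cinner (F1 \<xi>) (F \<xi>)"
    define B where "B = cinner (F \<xi>) (F1 \<xi>)"
    define E where "E = cinner (F1 \<xi>) (F1 \<xi>)"
    define P where "P = cinner (F2 \<xi>) (F \<xi>)"
    define k0 where "k0 = k (\<xi> * cnj \<xi>)"
    define k1 where "k1 = deriv k (\<xi> * cnj \<xi>)"
    \<comment> \<open>The coefficient of \<open>cnj w\<close> in the real derivative of \<open>\<psi>\<close> vanishes by the hypothesis.\<close>
    have "(\<psi> has_derivative (\<lambda>w.
      (- A * (inverse N * (A * w + B * cnj w) * inverse N) + (P * w + E * cnj w) / N) -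
      (k0 * cnj w + k1 * (cnj \<xi> * w + \<xi> * cnj w) * cnj \<xi>))) (at \<xi>)"
      unfolding \<psi>_def N_def A_def B_def E_def P_def k0_def k1_def
      by (intro has_derivative_diff has_derivative_divide has_derivative_mult has_derivative_radial
          has_derivative_cinner_holo has_derivative_cnj has_derivative_ident F F2 dk N \<xi>)
    moreover have "(- A * (inverse N * (A * w + B * cnj w) * inverse N) + (P * w + E * cnj w) / N) -
      (k0 * cnj w + k1 * (cnj \<xi> * w + \<xi> * cnj w) * cnj \<xi>)
      = (P / N - A\<^sup>2 / N\<^sup>2 - k1 * (cnj \<xi>)\<^sup>2) * w" for w
    proof -
      have "E / N - A * B / N\<^sup>2 = k0 + \<xi> * cnj \<xi> * k1"
        using eq[OF \<xi>] by (simp add: E_def N_def A_def B_def k0_def k1_def)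
      then have "(E / N - A * B / N\<^sup>2 - k0 - \<xi> * cnj \<xi> * k1) * cnj w = 0" by simp
      then show ?thesis
        by (simp add: divide_inverse power2_eq_square algebra_simps)
    qed
    ultimately show ?thesis
      by (auto simp: has_field_derivative_def fun_eq_iff intro!: exI[of _ "P / N - A\<^sup>2 / N\<^sup>2 - k1 * (cnj \<xi>)\<^sup>2"]
          elim!: has_derivative_eq_rhs)
  qed
  then have "\<psi> holomorphic_on ball 0 r" by (simp add: holomorphic_on_open)
  then obtain h where h: "\<And>\<xi>. \<xi> \<in> ball 0 r \<Longrightarrow> (h has_field_derivative \<psi> \<xi>) (at \<xi>)"
    using holomorphic_convex_primitive'[of "ball 0 r" \<psi>] by (auto simp: at_within_open[of _ "ball 0 r"])
  define G where "G = (\<lambda>\<xi>. exp (- h \<xi>) *\<^sub>C F \<xi>)"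
  define G1 where "G1 = (\<lambda>\<xi>. exp (- h \<xi>) *\<^sub>C (F1 \<xi> - \<psi> \<xi> *\<^sub>C F \<xi>))"
  have scale_diff: "a *\<^sub>C (x - y) = a *\<^sub>C x - a *\<^sub>C y" for a and x y :: l2
    by (rule bounded_bilinear.diff_right[OF bounded_bilinear_scaleC])
  have scale_minus: "(- a) *\<^sub>C x = - (a *\<^sub>C x)" for a and x :: l2
    by (rule bounded_bilinear.minus_left[OF bounded_bilinear_scaleC])
  have G: "(G has_derivative (\<lambda>w. w *\<^sub>C G1 \<xi>)) (at \<xi>)" if \<xi>: "\<xi> \<in> ball 0 r" for \<xi>
  proof -
    have "((\<lambda>\<xi>. exp (- h \<xi>)) has_field_derivative - \<psi> \<xi> * exp (- h \<xi>)) (at \<xi>)"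
      using h[OF \<xi>] by (auto intro!: derivative_eq_intros)
    then have "((\<lambda>\<xi>. exp (- h \<xi>)) has_derivative (*) (- \<psi> \<xi> * exp (- h \<xi>))) (at \<xi>)"
      by (simp add: has_field_derivative_def)
    from has_derivative_scaleC[OF this F[OF \<xi>]] show ?thesis
      unfolding G_def G1_def
      by (rule has_derivative_eq_rhs)
         (simp add: fun_eq_iff scaleC_scaleC scale_diff scale_minus mult_ac)
  qed
  have N: "cinner (G \<xi>) (G \<xi>) \<noteq> 0" if "\<xi> \<in> ball 0 r" for \<xi>
    using F0[OF that] norm_scaleC[of "exp (- h \<xi>)" "F \<xi>"] by (auto simp: cinner_self G_def)
  have A: "cinner (G1 \<xi>) (G \<xi>) = k (\<xi> * cnj \<xi>) * cnj \<xi> * cinner (G \<xi>) (G \<xi>)" if \<xi>: "\<xi> \<in> ball 0 r" for \<xi>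
  proof -
    have N: "cinner (F \<xi>) (F \<xi>) \<noteq> 0" using F0[OF \<xi>] by (simp add: cinner_self)
    then have "cinner (F1 \<xi>) (F \<xi>) - \<psi> \<xi> * cinner (F \<xi>) (F \<xi>)
       = k (\<xi> * cnj \<xi>) * cnj \<xi> * cinner (F \<xi>) (F \<xi>)"
      by (simp add: \<psi>_def algebra_simps)
    then show ?thesis
      by (simp add: G_def G1_def cinner_scaleC_left cinner_scaleC_right
          bounded_bilinear.diff_left[OF bounded_bilinear_cinner])
  qed
  define q where "q = (\<lambda>\<xi>. cinner (G \<xi>) (G \<xi>) / f (\<xi> * cnj \<xi>))"
  have dq: "(q has_derivative (\<lambda>w. 0)) (at \<xi>)" if \<xi>: "\<xi> \<in> ball 0 r" for \<xi>
  proof -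
    define M where "M = cinner (G \<xi>) (G \<xi>)"
    define k0 where "k0 = k (\<xi> * cnj \<xi>)"
    define f0 where "f0 = f (\<xi> * cnj \<xi>)"
    have f0: "f0 \<noteq> 0" using f(2)[OF ST[OF \<xi>]] by (simp add: f0_def)
    have B: "cinner (G \<xi>) (G1 \<xi>) = k0 * \<xi> * M"
    proof -
      have "cnj k0 = k0" using k[OF \<xi>] by (simp add: k0_def Reals_cnj_iff)
      moreover have "cnj M = M" by (simp add: M_def cnj_cinner)
      moreover have "cinner (G \<xi>) (G1 \<xi>) = cnj (cinner (G1 \<xi>) (G \<xi>))" by (simp add: cnj_cinner)
      ultimately show ?thesis using A[OF \<xi>] by (simp add: M_def k0_def)
    qed
    have "(q has_derivative (\<lambda>w.
       - cinner (G \<xi>) (G \<xi>) * (inverse (f (\<xi> * cnj \<xi>)) *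
           (k (\<xi> * cnj \<xi>) * f (\<xi> * cnj \<xi>) * (cnj \<xi> * w + \<xi> * cnj w)) * inverse (f (\<xi> * cnj \<xi>))) +
       (cinner (G1 \<xi>) (G \<xi>) * w + cinner (G \<xi>) (G1 \<xi>) * cnj w) / f (\<xi> * cnj \<xi>))) (at \<xi>)"
      unfolding q_def
      by (intro has_derivative_divide has_derivative_radial has_derivative_cinner_holo G f ST \<xi>)
    then show ?thesis
      by (rule has_derivative_eq_rhs)
         (use f0 in \<open>simp add: fun_eq_iff B A[OF \<xi>] flip: M_def k0_def f0_def,
           simp add: field_simps\<close>)
  qed
  have "\<exists>C. \<forall>\<xi>\<in>ball 0 r. q \<xi> = C"
    by (rule has_derivative_zero_constant[OF convex_ball has_derivative_at_withinI[OF dq]])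
  then obtain C where C: "\<And>\<xi>. \<xi> \<in> ball 0 r \<Longrightarrow> q \<xi> = C" by blast
  have eqC: "cinner (G \<xi>) (G \<xi>) = C * f (\<xi> * cnj \<xi>)" if "\<xi> \<in> ball 0 r" for \<xi>
    using C[OF that] f(2)[OF ST[OF that]] by (simp add: q_def field_simps)
  have "C \<noteq> 0" using eqC[of 0] N[of 0] r by auto
  with G eqC show ?thesis by blast
qed

section \<open>Pringsheim's theorem\<close>

lemma sums_nonneg_Reals:
  assumes "\<And>n. a n \<in> \<real>\<^sub>\<ge>\<^sub>0" "a sums (s :: complex)"
  shows "s \<in> \<real>\<^sub>\<ge>\<^sub>0"
proof (rule closed_sequentially[OF closed_nonneg_Reals_complex])
  show "sum a {..<n} \<in> \<real>\<^sub>\<ge>\<^sub>0" for n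
    by (induction n) (simp_all add: assms(1) nonneg_Reals_add_I)
qed (use assms(2) in \<open>simp add: sums_def\<close>)

lemma nonneg_of_nonneg_derivatives:
  assumes hol: "q holomorphic_on ball (complex_of_real a) R"
    and nn: "\<And>n. (deriv ^^ n) q (complex_of_real a) \<in> \<real>\<^sub>\<ge>\<^sub>0"
    and x: "a \<le> x" "x < a + R"
  shows "q (complex_of_real x) \<in> \<real>\<^sub>\<ge>\<^sub>0"
proof (rule sums_nonneg_Reals[OF _ holomorphic_power_series[OF hol]])
  show "complex_of_real x \<in> ball (complex_of_real a) R"
    using x by (simp add: dist_norm norm_minus_commute flip: of_real_diff)
  fix n
  have "complex_of_real ((x - a) ^ n / fact n) \<in> \<real>\<^sub>\<ge>\<^sub>0"
    unfolding nonneg_Reals_of_real_iff using x by simp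
  from nonneg_Reals_mult_I[OF nn[of n] this]
  show "(deriv ^^ n) q (complex_of_real a) / fact n * (complex_of_real x - complex_of_real a) ^ n \<in> \<real>\<^sub>\<ge>\<^sub>0"
    by simp
qed

lemma higher_deriv_power_series_remainder_0:
  assumes "f holomorphic_on T" "open T" "0 \<in> T"
  shows "(deriv ^^ n) (\<lambda>x. f x - (\<Sum>k\<le>K. (deriv ^^ k) f 0 / fact k * x ^ k)) 0
    = (if n \<le> K then 0 else (deriv ^^ n) f 0)"
proof -
  define p where "p = (\<lambda>x. \<Sum>k<Suc K. (deriv ^^ k) f 0 / fact k * x ^ k)"
  have p: "p = (\<lambda>x. \<Sum>k\<le>K. (deriv ^^ k) f 0 / fact k * x ^ k)"
    by (simp add: p_def lessThan_Suc_atMost)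
  have ph: "p holomorphic_on T" unfolding p_def by (intro holomorphic_intros)
  have monomial: "(deriv ^^ n) (\<lambda>x. x ^ k) (0::complex) = (if k = n then fact n else 0)" for k
    using higher_deriv_power[of n 0 k 0]
    by (cases k n rule: linorder_cases)
       (simp_all add: pochhammer_0_left Suc_diff_le power_0_left flip: pochhammer_fact)
  have "(deriv ^^ n) p 0
      = (\<Sum>k<Suc K. (deriv ^^ k) f 0 / fact k * (if k = n then fact n else 0))"
    unfolding p_def monomial[symmetric]
    by (rule higher_deriv_comb[where f = "\<lambda>k x. x ^ k", OF _ assms(2,3)]) (intro holomorphic_intros)
  also have "\<dots> = (\<Sum>k<Suc K. if k = n then (deriv ^^ n) f 0 else 0)"
    by (intro sum.cong) auto
  also have "\<dots> = (if n \<le> K then (deriv ^^ n) f 0 else 0)"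
    by (subst sum.delta) auto
  finally show ?thesis
    using higher_deriv_diff[OF assms(1) ph assms(2,3)] by (simp add: p)
qed

text \<open>Each Taylor remainder \<open>q = f - \<Sum>\<^sub>k\<^sub>\<le>\<^sub>K a\<^sub>k x\<^sup>k\<close> has nonnegative derivatives at 0, hence also at
  \<open>x0\<close>, hence nonnegative values on \<open>[x0, x0 + R)\<close>. So \<open>f\<close> dominates there all partial sums of its
  Taylor series at 0, and this series converges on the disc of radius \<open>x0 + R\<close>.\<close>

theorem pringsheim_extension:
  assumes f: "f holomorphic_on T" "open T"
    and \<rho>: "ball 0 \<rho> \<subseteq> T" and x0: "0 < x0" "x0 < \<rho>"
    and R: "ball (complex_of_real x0) R \<subseteq> T" "R > 0"
    and nn: "\<And>n. (deriv ^^ n) f 0 \<in> \<real>\<^sub>\<ge>\<^sub>0"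
  shows "\<exists>g. g holomorphic_on ball 0 (x0 + R) \<and> (\<forall>w\<in>ball 0 \<rho>. g w = f w)"
proof -
  define a where "a = (\<lambda>k. (deriv ^^ k) f 0 / fact k)"
  have T0: "0 \<in> T" using \<rho> x0 by auto
  have ann: "a k \<in> \<real>\<^sub>\<ge>\<^sub>0" for k
    using nonneg_Reals_mult_I[OF nn, of "complex_of_real (1 / fact k)" k]
    unfolding nonneg_Reals_of_real_iff by (simp add: a_def)
  have le: "(\<Sum>k<Suc K. norm (a k * complex_of_real x ^ k)) \<le> cmod (f (complex_of_real x))"
    if x: "x0 \<le> x" "x < x0 + R" for K x
  proof -
    define q where "q = (\<lambda>x. f x - (\<Sum>k\<le>K. (deriv ^^ k) f 0 / fact k * x ^ k))"
    have q: "q holomorphic_on T" unfolding q_def by (intro holomorphic_intros f)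
    have q0: "(deriv ^^ n) q 0 \<in> \<real>\<^sub>\<ge>\<^sub>0" for n
      unfolding q_def higher_deriv_power_series_remainder_0[OF f T0] using nn by simp
    have "(deriv ^^ n) q (complex_of_real x0) \<in> \<real>\<^sub>\<ge>\<^sub>0" for n
    proof (rule nonneg_of_nonneg_derivatives[where a = 0 and R = \<rho>])
      show "(deriv ^^ n) q holomorphic_on ball (complex_of_real 0) \<rho>"
        by (rule holomorphic_on_subset[OF holomorphic_higher_deriv[OF q f(2)]]) (use \<rho> in simp)
      show "(deriv ^^ j) ((deriv ^^ n) q) (complex_of_real 0) \<in> \<real>\<^sub>\<ge>\<^sub>0" for j
        using q0[of "j + n"] by (simp add: funpow_add)
    qed (use x0 in auto)
    then have "q (complex_of_real x) \<in> \<real>\<^sub>\<ge>\<^sub>0"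
      by (intro nonneg_of_nonneg_derivatives[OF holomorphic_on_subset[OF q R(1)] _ x]) auto
    then have "0 \<le> Re (q (complex_of_real x))" by (simp add: complex_nonneg_Reals_iff)
    moreover have "a k * complex_of_real x ^ k = complex_of_real (norm (a k * complex_of_real x ^ k))" for k
    proof -
      have "a k * complex_of_real (x ^ k) \<in> \<real>\<^sub>\<ge>\<^sub>0"
        using x x0 by (intro nonneg_Reals_mult_I ann) (simp only: nonneg_Reals_of_real_iff, simp)
      then show ?thesis by (auto elim!: nonneg_Reals_cases simp flip: of_real_power)
    qed
    then have "(\<Sum>k<Suc K. a k * complex_of_real x ^ k)
        = complex_of_real (\<Sum>k<Suc K. norm (a k * complex_of_real x ^ k))"
      unfolding of_real_sum by (intro sum.cong refl)
    then have "q (complex_of_real x) = f (complex_of_real x)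
        - complex_of_real (\<Sum>k<Suc K. norm (a k * complex_of_real x ^ k))"
      by (simp only: q_def a_def lessThan_Suc_atMost)
    ultimately show ?thesis
      using complex_Re_le_cmod[of "f (complex_of_real x)"] by simp
  qed
  have summ: "summable (\<lambda>k. a k * w ^ k)" if w: "w \<in> ball 0 (x0 + R)" for w
  proof -
    define x where "x = max x0 (cmod w)"
    have x: "x0 \<le> x" "x < x0 + R" "cmod w \<le> x" using w R by (auto simp: x_def)
    have "summable (\<lambda>k. norm (a k * complex_of_real x ^ k))"
    proof (rule summableI_nonneg_bounded)
      fix n
      have "(\<Sum>k<n. norm (a k * complex_of_real x ^ k)) \<le> (\<Sum>k<Suc n. norm (a k * complex_of_real x ^ k))"
        by simp
      then show "(\<Sum>k<n. norm (a k * complex_of_real x ^ k)) \<le> cmod (f (complex_of_real x))"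
        using le[OF x(1,2), of n] by linarith
    qed simp
    then show ?thesis
      using x x0 by (elim summable_comparison_test'[where N = 0])
        (auto simp: norm_mult norm_power intro!: mult_left_mono power_mono)
  qed
  define g where "g = (\<lambda>w. \<Sum>k. a k * w ^ k)"
  have "g holomorphic_on ball 0 (x0 + R)"
    using summable_sums[OF summ] by (intro power_series_holomorphic[of 0 _ a]) (simp add: g_def)
  moreover have "g w = f w" if "w \<in> ball 0 \<rho>" for w
    using sums_unique[OF holomorphic_power_series[OF holomorphic_on_subset[OF f(1) \<rho>] that]]
    by (simp add: g_def a_def)
  ultimately show ?thesis by blast
qed

section \<open>The branch point of the exponentiated potential\<close>

text \<open>The half-plane on which \<open>1 + c x\<close> has positive real part, so that its principal square root is
  holomorphic.\<close>

definition root_dom :: "real \<Rightarrow> complex set" where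
  "root_dom c = {x. 0 < 1 + c * Re x}"

definition eh_root :: "real \<Rightarrow> complex \<Rightarrow> complex" where
  "eh_root c x = csqrt (1 + of_real c * x)"

text \<open>The complexification of \<open>m\<close> times \<open>eh_slope c\<close>.\<close>

definition eh_log_deriv :: "nat \<Rightarrow> real \<Rightarrow> complex \<Rightarrow> complex" where
  "eh_log_deriv m c x = of_nat m * of_real c / (2 * (eh_root c x + 1))"

text \<open>The complexification of \<open>exp (m eh_u c x)\<close>.\<close>

definition eh_exp :: "nat \<Rightarrow> real \<Rightarrow> complex \<Rightarrow> complex" where
  "eh_exp m c x = exp (of_nat m * (eh_root c x - 1)) * (2 / (eh_root c x + 1)) ^ m"

lemma open_root_dom: "open (root_dom c)"
  unfolding root_dom_def by (intro open_Collect_less continuous_intros)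

lemma
  assumes "x \<in> root_dom c"
  shows eh_root_nonzero: "eh_root c x \<noteq> 0"
    and eh_root_add_1_nonzero: "eh_root c x + 1 \<noteq> 0"
    and eh_root_sq: "(eh_root c x)\<^sup>2 = 1 + of_real c * x"
    and DERIV_eh_root: "(eh_root c has_field_derivative of_real c / (2 * eh_root c x)) (at x)"
proof -
  have "0 < Re (1 + of_real c * x)" using assms by (simp add: root_dom_def)
  then have n: "1 + of_real c * x \<notin> \<real>\<^sub>\<le>\<^sub>0" by (auto simp: complex_nonpos_Reals_iff)
  then have "1 + of_real c * x \<noteq> 0" by auto
  then show "eh_root c x \<noteq> 0" by (simp add: eh_root_def)
  have "Re (eh_root c x) \<ge> 0" unfolding eh_root_def by (rule Re_csqrt)
  then have "Re (eh_root c x + 1) \<noteq> 0" by simp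
  then show "eh_root c x + 1 \<noteq> 0" by (metis zero_complex.simps(1))
  show "(eh_root c x)\<^sup>2 = 1 + of_real c * x" by (simp add: eh_root_def)
  show "(eh_root c has_field_derivative of_real c / (2 * eh_root c x)) (at x)"
    unfolding eh_root_def
  proof (rule DERIV_cong[OF DERIV_chain2[where f = csqrt and x = x]])
    show "(csqrt has_field_derivative inverse (2 * csqrt (1 + of_real c * x))) (at (1 + of_real c * x))"
      by (rule has_field_derivative_csqrt[OF n])
    show "((\<lambda>x. 1 + of_real c * x) has_field_derivative of_real c) (at x)"
      by (auto intro!: derivative_eq_intros)
  qed (simp add: field_simps)
qed

lemma DERIV_eh_exp:
  assumes "x \<in> root_dom c"
  shows "(eh_exp m c has_field_derivative eh_log_deriv m c x * eh_exp m c x) (at x)"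
proof -
  define s where "s = eh_root c x"
  note nz = eh_root_nonzero[OF assms, folded s_def] eh_root_add_1_nonzero[OF assms, folded s_def]
  note s' = DERIV_eh_root[OF assms, folded s_def]
  have e: "((\<lambda>x. exp (of_nat m * (eh_root c x - 1))) has_field_derivative
     exp (of_nat m * (s - 1)) * (of_nat m * (of_real c / (2 * s)))) (at x)"
    using s' by (auto intro!: derivative_eq_intros simp: s_def)
  have t: "((\<lambda>x. 2 / (eh_root c x + 1)) has_field_derivative
     - (2 * (of_real c / (2 * s))) / (s + 1)\<^sup>2) (at x)"
    using s' nz by (auto intro!: derivative_eq_intros simp: s_def power2_eq_square)
  have "((\<lambda>x. (2 / (eh_root c x + 1)) ^ m) has_field_derivative
     of_nat m * (2 / (s + 1)) ^ m * (- (of_real c / (2 * s)) / (s + 1))) (at x)"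
  proof (cases m)
    case (Suc n)
    have "of_nat (Suc n) * (- (2 * (of_real c / (2 * s))) / (s + 1)\<^sup>2 * (2 / (s + 1)) ^ n)
       = of_nat m * (2 / (s + 1)) ^ m * (- (of_real c / (2 * s)) / (s + 1))"
      using nz by (simp add: Suc divide_simps power2_eq_square)
    with DERIV_power[OF t, of "Suc n"] show ?thesis by (simp add: Suc s_def)
  qed simp
  from DERIV_mult[OF e this] show ?thesis
    unfolding eh_exp_def
  proof (rule DERIV_cong, goal_cases)
    case 1
    have "of_nat m * (of_real c / (2 * s)) + of_nat m * (- (of_real c / (2 * s)) / (s + 1)) = eh_log_deriv m c x"
      using nz by (simp add: eh_log_deriv_def divide_simps del: distrib_left_numeral flip: s_def)
        (simp add: algebra_simps)
    then have "eh_log_deriv m c x * (exp (of_nat m * (s - 1)) * (2 / (s + 1)) ^ m)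
       = (of_nat m * (of_real c / (2 * s)) + of_nat m * (- (of_real c / (2 * s)) / (s + 1)))
         * (exp (of_nat m * (s - 1)) * (2 / (s + 1)) ^ m)" by simp
    then show ?case unfolding s_def[symmetric] by (simp only: algebra_simps)
  qed
qed

lemma DERIV_eh_log_deriv:
  assumes "x \<in> root_dom c"
  shows "(eh_log_deriv m c has_field_derivative
     - of_nat m * (of_real c)\<^sup>2 / (4 * eh_root c x * (eh_root c x + 1)\<^sup>2)) (at x)"
proof -
  define s where "s = eh_root c x"
  note nz = eh_root_nonzero[OF assms, folded s_def] eh_root_add_1_nonzero[OF assms, folded s_def]
  note s' = DERIV_eh_root[OF assms, folded s_def]
  have "(eh_log_deriv m c has_field_derivative
     - (of_nat m * of_real c * (2 * (of_real c / (2 * s)))) / (2 * (s + 1))\<^sup>2) (at x)"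
    unfolding eh_log_deriv_def using s' nz
    by (auto intro!: derivative_eq_intros simp: power2_eq_square s_def simp del: distrib_left_numeral)
  then show ?thesis
    by (rule DERIV_cong)
       (use nz in \<open>simp add: power2_eq_square divide_simps del: distrib_left_numeral flip: s_def\<close>)
qed

lemma eh_log_deriv_laplacian:
  assumes "x \<in> root_dom c"
  shows "eh_log_deriv m c x + x * deriv (eh_log_deriv m c) x = of_nat m * of_real c / (4 * eh_root c x)"
proof -
  define s where "s = eh_root c x"
  note nz = eh_root_nonzero[OF assms, folded s_def] eh_root_add_1_nonzero[OF assms, folded s_def]
  have "of_real c * x = (s - 1) * (s + 1)"
    using eh_root_sq[OF assms, folded s_def] by (simp add: power2_eq_square algebra_simps)
  moreover have "x * deriv (eh_log_deriv m c) x = - (of_nat m * of_real c * (of_real c * x)) / (4 * s * (s + 1)\<^sup>2)"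
    unfolding DERIV_imp_deriv[OF DERIV_eh_log_deriv[OF assms]] s_def by (simp add: power2_eq_square mult_ac)
  ultimately have "x * deriv (eh_log_deriv m c) x
      = - (of_nat m * of_real c * ((s - 1) * (s + 1))) / (4 * s * (s + 1)\<^sup>2)" by simp
  moreover have "eh_log_deriv m c x = of_nat m * of_real c / (2 * (s + 1))"
    by (simp add: eh_log_deriv_def s_def)
  ultimately show ?thesis
    using nz unfolding s_def[symmetric]
    by (simp only:) (simp add: divide_simps del: distrib_left_numeral,
      simp add: power2_eq_square algebra_simps)
qed

lemma eh_exp_nonzero: "x \<in> root_dom c \<Longrightarrow> eh_exp m c x \<noteq> 0"
  using eh_root_add_1_nonzero by (simp add: eh_exp_def)

lemma ball_subset_root_dom:
  assumes "c > 0" "a \<ge> 0"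
  shows "ball (complex_of_real a) (a + 1 / c) \<subseteq> root_dom c"
proof
  fix x assume "x \<in> ball (complex_of_real a) (a + 1 / c)"
  then have "a - Re x < a + 1 / c"
    using complex_Re_le_cmod[of "complex_of_real a - x"] by (simp add: dist_norm)
  then have "- Re x < 1 / c" by simp
  then show "x \<in> root_dom c" using assms(1) by (simp add: root_dom_def field_simps)
qed

lemma eh_exp_lower_bound:
  assumes "c > 0" "x \<in> ball 0 (1 / c)"
  shows "exp (- real m) * (2 / 3) ^ m \<le> cmod (eh_exp m c x)"
proof -
  define s where "s = eh_root c x"
  have Re: "Re s \<ge> 0" unfolding s_def eh_root_def by (rule Re_csqrt)
  have xd: "x \<in> root_dom c" using ball_subset_root_dom[of c 0] assms by auto
  have "cmod (of_real c * x) \<le> 1" using assms by (simp add: norm_mult field_simps)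
  moreover have "(cmod s)\<^sup>2 = cmod (1 + of_real c * x)"
    by (simp only: s_def eh_root_sq[OF xd] flip: norm_power)
  ultimately have "(cmod s)\<^sup>2 \<le> 2"
    using norm_triangle_ineq[of 1 "of_real c * x"] by simp
  then have "(cmod s)\<^sup>2 \<le> 2\<^sup>2" by simp
  then have "cmod s \<le> 2" by (rule power2_le_imp_le) simp
  then have "cmod (s + 1) \<le> 3" using norm_triangle_ineq[of s 1] by simp
  moreover have "cmod (s + 1) > 0" using eh_root_add_1_nonzero[OF xd] by (simp add: s_def)
  ultimately have "2 / 3 \<le> cmod (2 / (s + 1))" by (simp add: norm_divide field_simps)
  then have "(2 / 3) ^ m \<le> cmod (2 / (s + 1)) ^ m" by (rule power_mono) simp
  moreover have "exp (- real m) \<le> cmod (exp (of_nat m * (s - 1)))"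
    using Re by (simp add: norm_exp_eq_Re algebra_simps)
  ultimately have "exp (- real m) * (2 / 3) ^ m
      \<le> cmod (exp (of_nat m * (s - 1))) * cmod (2 / (s + 1)) ^ m"
    by (intro mult_mono) simp_all
  then show ?thesis
    by (simp only: eh_exp_def norm_mult norm_power s_def)
qed

text \<open>Write \<open>E\<close> for \<open>eh_exp m c\<close>. From \<open>E' / E = m c / (2 (s + 1))\<close> one gets
  \<open>m c E - 2 E' = 2 s E'\<close>, and squaring removes the square root:
  \<open>(m c E - 2 E')\<^sup>2 = 4 E'\<^sup>2 (1 + c x)\<close>. An extension \<open>g\<close> satisfies this identity at \<open>-1/c\<close>, where it reads
  \<open>m c g = 2 g'\<close>; its derivative there then reads \<open>0 = 4 c g'\<^sup>2\<close>. So \<open>g\<close> vanishes at \<open>-1/c\<close>, although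
  \<open>|E|\<close> is bounded below by a positive constant on the disc of radius \<open>1/c\<close>.\<close>

lemma no_extension_beyond_branch_point:
  assumes c: "c > 0" and m: "m > 0" and r: "r > 1 / c"
    and g: "g holomorphic_on ball 0 r" "\<And>w. w \<in> ball 0 (1 / c) \<Longrightarrow> g w = eh_exp m c w"
  shows False
proof -
  define p where "p = (\<lambda>x. (of_nat m * of_real c * g x - 2 * deriv g x)\<^sup>2 -
      4 * (deriv g x)\<^sup>2 * (1 + of_real c * x))"
  define b where "b = complex_of_real (- 1 / c)"
  have b: "b \<in> ball 0 r" using r c by (simp add: b_def norm_divide)
  have cb: "1 + of_real c * b = 0" using c by (simp add: b_def)
  have p0: "p x = 0" if x: "x \<in> ball 0 (1 / c)" for x
  proof -
    have xd: "x \<in> root_dom c" using ball_subset_root_dom[of c 0] c x by auto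
    define s where "s = eh_root c x"
    have s1: "s + 1 \<noteq> 0" "s\<^sup>2 = 1 + of_real c * x"
      using eh_root_add_1_nonzero[OF xd] eh_root_sq[OF xd] by (simp_all add: s_def)
    have "(g has_field_derivative eh_log_deriv m c x * eh_exp m c x) (at x)"
      by (rule has_field_derivative_transform_within_open[OF DERIV_eh_exp[OF xd] open_ball x])
         (simp add: g(2))
    then have "deriv g x = of_nat m * of_real c / (2 * (s + 1)) * g x"
      by (simp add: DERIV_imp_deriv g(2)[OF x] eh_log_deriv_def s_def)
    then have "of_nat m * of_real c * g x = 2 * (s + 1) * deriv g x"
      using s1 by (simp del: distrib_left_numeral)
    then have "of_nat m * of_real c * g x - 2 * deriv g x = 2 * s * deriv g x"
      by (simp add: algebra_simps)
    then show ?thesis by (simp add: p_def power_mult_distrib flip: s1(2))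
  qed
  have gh: "deriv g holomorphic_on ball 0 r" by (intro holomorphic_deriv g open_ball)
  have ph: "p holomorphic_on ball 0 r"
    unfolding p_def by (intro holomorphic_intros g gh)
  have pr: "p x = 0" if "x \<in> ball 0 r" for x
    by (rule analytic_continuation_open[of "ball 0 (1 / c)" "ball 0 r" p "\<lambda>_. 0"])
       (use c r ph p0 that in auto)
  define g0 where "g0 = g b"
  define g1 where "g1 = deriv g b"
  define g2 where "g2 = deriv (deriv g) b"
  have dg: "(g has_field_derivative g1) (at b)" "(deriv g has_field_derivative g2) (at b)"
    unfolding g1_def g2_def
    by (rule holomorphic_derivI[OF g(1) open_ball b], rule holomorphic_derivI[OF gh open_ball b])
  have mg: "of_nat m * of_real c * g0 = 2 * g1"
    using pr[OF b] cb by (simp add: p_def g0_def g1_def)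
  have "((\<lambda>x. (of_nat m * of_real c * g x - 2 * deriv g x)\<^sup>2 -
      4 * (deriv g x)\<^sup>2 * (1 + of_real c * x)) has_field_derivative
      2 * (of_nat m * of_real c * g0 - 2 * g1) * (of_nat m * of_real c * g1 - 2 * g2)
      - (8 * g1 * g2 * (1 + of_real c * b) + 4 * g1\<^sup>2 * of_real c)) (at b)"
    using dg by (auto intro!: derivative_eq_intros simp: g0_def g1_def g2_def algebra_simps power2_eq_square)
  then have "(p has_field_derivative - (4 * g1\<^sup>2 * of_real c)) (at b)"
    by (simp add: p_def mg cb)
  moreover have "(p has_field_derivative 0) (at b)"
    by (rule has_field_derivative_transform_within_open[OF DERIV_const[of 0] open_ball b]) (simp add: pr)
  ultimately have "- (4 * g1\<^sup>2 * of_real c) = 0" by (rule DERIV_unique)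
  then have "g1 = 0" using c by simp
  with mg c m have gb: "g b = 0" by (simp add: g0_def)
  have "exp (- real m) * (2 / 3) ^ m \<le> cmod (g b)"
  proof (rule continuous_ge_on_closure[where f = "\<lambda>x. cmod (g x)" and x = b])
    have "cball 0 (1 / c) \<subseteq> ball (0::complex) r" using r by auto
    then show "continuous_on (closure (ball 0 (1 / c))) (\<lambda>x. cmod (g x))"
      using c holomorphic_on_imp_continuous_on[OF g(1)]
      by (auto intro!: continuous_on_norm intro: continuous_on_subset)
    show "b \<in> closure (ball 0 (1 / c))" using c by (simp add: b_def norm_divide)
  qed (use c in \<open>auto simp: g(2) intro!: eh_exp_lower_bound\<close>)
  moreover have "exp (- real m) * (2 / 3) ^ m > 0" by simp
  ultimately show False using gb by simp
qed

section \<open>The immersion restricted to a fibre\<close>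

lemma of_real_norm_sq_in_root_dom: "c > 0 \<Longrightarrow> \<xi> * cnj \<xi> \<in> root_dom c"
  by (simp add: root_dom_def complex_mult_cnj add_pos_nonneg flip: power2_eq_square)

lemma eh_root_norm_sq:
  assumes "c > 0"
  shows "eh_root c (\<xi> * cnj \<xi>) = complex_of_real (sqrt (1 + c * (norm \<xi>)\<^sup>2))"
proof -
  have "1 + of_real c * (\<xi> * cnj \<xi>) = complex_of_real (1 + c * (norm \<xi>)\<^sup>2)"
    by (simp flip: complex_norm_square)
  then show ?thesis
    unfolding eh_root_def using assms by (simp only: csqrt_of_real_nonneg) (simp add: csqrt_of_real_nonneg)
qed

theorem corollary1:
  fixes m :: nat and c :: real
  assumes "m > 0" and "c > 0"
  shows "\<not> projectively_induced eh_dom eh_param (\<lambda>i p u v. real m * eh_metric c i p u v)"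
proof
  assume "projectively_induced eh_dom eh_param (\<lambda>i p u v. real m * eh_metric c i p u v)"
  then obtain f where holo: "holo_map eh_dom eh_param f"
    and iso: "isometric eh_dom eh_param (\<lambda>i p u v. real m * eh_metric c i p u v) f"
    by (auto simp: projectively_induced_def kahler_immersion_def)
  have "(0, 0) \<in> eh_dom False" by (simp add: eh_dom_def)
  then obtain U F where U0: "(0, 0) \<in> U" and UD: "U \<subseteq> eh_dom False"
    and lift: "holo_lift (eh_param False) f U F"
    using holo unfolding holo_map_def by blast
  have U: "open U" "holo_on F U" and F0: "\<And>p. p \<in> U \<Longrightarrow> F p \<noteq> 0"
    using lift by (auto simp: holo_lift_def)
  obtain r where r: "r > 0" "ball (0, 0) r \<subseteq> U" using U(1) U0 open_contains_ball by blast
  have inU: "(0, \<xi>) \<in> U" if "\<xi> \<in> ball 0 r" for \<xi> :: complex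
    using that r(2) by (auto simp: dist_Pair_Pair)
  define Z where "Z = (\<lambda>\<xi>. F (0, \<xi>))"
  define Z1 where "Z1 = (\<lambda>\<xi>. frechet_derivative F (at (0, \<xi>)) (0, 1))"
  have Z: "(Z has_derivative (\<lambda>w. w *\<^sub>C Z1 \<xi>)) (at \<xi>)" if \<xi>: "\<xi> \<in> ball 0 r" for \<xi>
  proof -
    obtain F' where F': "(F has_derivative F') (at (0, \<xi>))" "\<And>a v. F' (a *\<^sub>C v) = a *\<^sub>C F' v"
      using U(2) inU[OF \<xi>] unfolding holo_on_def by blast
    have "((\<lambda>\<xi>. (0 :: complex, \<xi>)) has_derivative (\<lambda>w. (0, w))) (at \<xi>)"
      by (auto intro!: derivative_eq_intros)
    from has_derivative_compose[OF this F'(1)] show ?thesis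
      unfolding Z_def Z1_def frechet_derivative_eq[OF F'(1)]
      by (rule has_derivative_eq_rhs)
         (simp add: fun_eq_iff scaleC_prod_def scaleC_complex_def flip: F'(2))
  qed
  \<comment> \<open>The isometry condition in the direction of the fibre.\<close>
  have eq: "cinner (Z1 \<xi>) (Z1 \<xi>) / cinner (Z \<xi>) (Z \<xi>) -
      cinner (Z1 \<xi>) (Z \<xi>) * cinner (Z \<xi>) (Z1 \<xi>) / (cinner (Z \<xi>) (Z \<xi>))\<^sup>2
      = eh_log_deriv m c (\<xi> * cnj \<xi>) + \<xi> * cnj \<xi> * deriv (eh_log_deriv m c) (\<xi> * cnj \<xi>)"
    (is "?L = ?R") if \<xi>: "\<xi> \<in> ball 0 r" for \<xi>
  proof -
    have "cnj ?L = ?L" by (simp add: cnj_cinner mult.commute)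
    then have L: "?L = complex_of_real (Re ?L)" by (metis Reals_cnj_iff of_real_Re)
    have "fs_metric (Z \<xi>) (Z1 \<xi>) (Z1 \<xi>) = real m * eh_metric c False (0, \<xi>) (0, 1) (0, 1)"
      using iso UD lift inU[OF \<xi>] unfolding isometric_def Z_def Z1_def by blast
    then have "Re ?L / pi = real m * c / (4 * sqrt (1 + c * (norm \<xi>)\<^sup>2)) / pi"
      using F0[OF inU[OF \<xi>]] unfolding eh_metric_fibre[OF \<open>c > 0\<close>] by (simp add: fs_metric_diag Z_def)
    then have ReL: "Re ?L = real m * c / (4 * sqrt (1 + c * (norm \<xi>)\<^sup>2))"
      using pi_neq_zero by (simp only: divide_cancel_right simp_thms)
    have "?R = of_nat m * of_real c / (4 * eh_root c (\<xi> * cnj \<xi>))"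
      by (rule eh_log_deriv_laplacian[OF of_real_norm_sq_in_root_dom[OF \<open>c > 0\<close>]])
    also have "\<dots> = complex_of_real (Re ?L)"
      unfolding ReL eh_root_norm_sq[OF \<open>c > 0\<close>] by simp
    finally show ?thesis using L by simp
  qed
  have dom: "\<xi> * cnj \<xi> \<in> root_dom c" for \<xi>
    by (rule of_real_norm_sq_in_root_dom[OF \<open>c > 0\<close>])
  have lh: "eh_log_deriv m c holomorphic_on root_dom c"
    using DERIV_eh_log_deriv by (auto simp: holomorphic_on_open open_root_dom)
  have eh: "eh_exp m c holomorphic_on root_dom c"
    using DERIV_eh_exp by (auto simp: holomorphic_on_open open_root_dom)
  have "\<exists>(G :: complex \<Rightarrow> l2) G1 C. C \<noteq> 0 \<and> (\<forall>\<xi>\<in>ball 0 r.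
     (G has_derivative (\<lambda>w. w *\<^sub>C G1 \<xi>)) (at \<xi>) \<and> cinner (G \<xi>) (G \<xi>) = C * eh_exp m c (\<xi> * cnj \<xi>))"
  proof (rule holomorphic_normalization[OF r(1) open_root_dom lh _ _ _ _ Z _ eq])
    show "eh_log_deriv m c (\<xi> * cnj \<xi>) \<in> \<real>" for \<xi>
      unfolding eh_log_deriv_def eh_root_norm_sq[OF \<open>c > 0\<close>] by (intro Reals_divide Reals_mult Reals_add) auto
    show "Z \<xi> \<noteq> 0" if "\<xi> \<in> ball 0 r" for \<xi> using F0[OF inU[OF that]] by (simp add: Z_def)
  qed (use dom in \<open>auto intro: DERIV_eh_exp dest: eh_exp_nonzero\<close>)
  then obtain G G1 :: "complex \<Rightarrow> l2" and C where C: "C \<noteq> 0"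
    and G: "\<And>\<xi>. \<xi> \<in> ball 0 r \<Longrightarrow> (G has_derivative (\<lambda>w. w *\<^sub>C G1 \<xi>)) (at \<xi>)"
    and GG: "\<And>\<xi>. \<xi> \<in> ball 0 r \<Longrightarrow> cinner (G \<xi>) (G \<xi>) = C * eh_exp m c (\<xi> * cnj \<xi>)" by blast
  define \<phi> where "\<phi> = (\<lambda>x. C * eh_exp m c x)"
  have \<phi>: "\<phi> holomorphic_on root_dom c" unfolding \<phi>_def by (intro holomorphic_intros eh)
  have nn: "(deriv ^^ k) \<phi> 0 \<in> \<real>\<^sub>\<ge>\<^sub>0" for k
    by (rule taylor_coefficients_nonneg[where S = "ball 0 r", OF open_ball _ open_root_dom \<phi> dom G])
       (use r(1) GG in \<open>auto simp: \<phi>_def\<close>)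
  \<comment> \<open>The largest disc about \<open>1 / (2c)\<close> in the half-plane has radius \<open>1 / (2c) + 1 / c\<close>; thus the
    Taylor series at 0 converges on the disc of radius \<open>2 / c\<close>.\<close>
  have "\<exists>g. g holomorphic_on ball 0 (1 / (2 * c) + (1 / (2 * c) + 1 / c)) \<and> (\<forall>w\<in>ball 0 (1 / c). g w = \<phi> w)"
    by (rule pringsheim_extension[OF \<phi> open_root_dom _ _ _ _ _ nn])
       (use \<open>c > 0\<close> ball_subset_root_dom[of c 0] ball_subset_root_dom[of c "1 / (2 * c)"]
         in \<open>auto simp: field_simps\<close>)
  then obtain g where g: "g holomorphic_on ball 0 (1 / (2 * c) + (1 / (2 * c) + 1 / c))"
    "\<And>w. w \<in> ball 0 (1 / c) \<Longrightarrow> g w = \<phi> w" by blast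
  show False
  proof (rule no_extension_beyond_branch_point[OF \<open>c > 0\<close> \<open>m > 0\<close>])
    show "(\<lambda>w. g w / C) holomorphic_on ball 0 (1 / (2 * c) + (1 / (2 * c) + 1 / c))"
      using C by (intro holomorphic_intros g(1)) auto
  qed (use \<open>c > 0\<close> C g(2) in \<open>auto simp: \<phi>_def divide_strict_right_mono\<close>)
qed

end
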